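(* Let $U>0$, $\Theta_0>0$, and let $P\in C^2(\mathbb{R}_+)$ satisfy: (i) there exist $m>1$ and $A>0$ such that $P(H)=\frac{A}{m-1}H^{1-m}(1+o(1))$ as $H\to 0^+$; (ii) $\lim_{H\to+\infty}P(H)=\lim_{H\to+\infty}P'(H)=0$, and there exists $p>1$ such that $H^{p+1}P''(H)=O(1)$ as $H\to+\infty$; (iii) $\inf_{H>0}P(H)+\Theta_0>0$. Then there exists a unique function $H$ which is a solution (in the sense given in the context) of the problem $$H^2\,(H_{yy}-P'(H))_y=-U \ \text{ in } \mathbb{R}_+,\qquad H(0)=0,\qquad H>0 \ \text{ in } \mathbb{R}_+,$$ $$\lim_{y\to+\infty}\frac{H_y^3(y)}{\ln y}=3U,\qquad \lim_{y\to0^+}\left(\tfrac12 H_y^2(y)-P(H(y))\right)=\Theta_0,$$ and which satisfies $H_y>0$ in $\mathbb{R}_+$. Furthermore, this $H$ satisfies $$H(y)=\alpha\, y^{\frac{2}{m+1}}(1+o(1)),\qquad H_y(y)=\tfrac{2\alpha}{m+1}\,y^{\frac{1-m}{m+1}}(1+o(1))\qquad\text{as } y\to0^+,\qquad \alpha=\left(\tfrac{A(m+1)^2}{2(m-1)}\right)^{\frac1{m+1}},$$ and there exists $B>0$ such that $$\tfrac{1}{3U}H_y^3(y(H))=\ln H-\tfrac13\ln\ln H+\ln B+O\!\left(\tfrac{\ln\ln H}{\ln H}\right)\qquad\text{as } H\to+\infty,$$ where $H\mapsto y(H)$ denotes the inverse function of $y\mapsto H(y)$.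
   Context: $\mathbb{R}_+=(0,+\infty)$ and $\overline{\mathbb{R}}_+=[0,+\infty)$. Subscript $y$ denotes differentiation with respect to $y$, and $P'$, $P''$ are derivatives of $P$ with respect to its argument. A solution of the problem is a function $H\in C^3(\mathbb{R}_+)\cap C^0(\overline{\mathbb{R}}_+)$ which satisfies the differential equation $H^2(H_{yy}-P'(H))_y=-U$ pointwise in $\mathbb{R}_+$ and all the other listed conditions ($H(0)=0$, positivity in $\mathbb{R}_+$, and the two limit conditions as $y\to+\infty$ and $y\to0^+$). Uniqueness means uniqueness within the class of solutions with $H_y>0$ in $\mathbb{R}_+$. *)

theory Defs
  imports "HOL-Analysis.Analysis"
begin

text \<open>Meant for open \<open>S\<close>, where the iterated \<^const>\<open>deriv\<close> at a point of \<open>S\<close>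
  depends only on the values of \<open>f\<close> on \<open>S\<close>.\<close>

definition C_diff_on :: "nat \<Rightarrow> (real \<Rightarrow> real) \<Rightarrow> real set \<Rightarrow> bool" where
  "C_diff_on k f S \<longleftrightarrow>
     (\<forall>j<k. \<forall>x\<in>S. (deriv ^^ j) f field_differentiable at x) \<and>
     continuous_on S ((deriv ^^ k) f)"

text \<open>The profile \<open>H\<close> lives on \<open>[0, \<infinity>)\<close>; its values on negative arguments are irrelevant.
  The derivatives below are genuine: \<open>H\<close> is of class \<open>C\<^sup>3\<close> and positive on \<open>(0, \<infinity>)\<close>,
  and the predicate is used only for \<open>P\<close> of class \<open>C\<^sup>2\<close> there.\<close>

definition is_solution :: "real \<Rightarrow> real \<Rightarrow> (real \<Rightarrow> real) \<Rightarrow> (real \<Rightarrow> real) \<Rightarrow> bool" where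
  "is_solution U \<Theta>\<^sub>0 P H \<longleftrightarrow>
     C_diff_on 3 H {0<..} \<and> continuous_on {0..} H \<and>
     (\<forall>y>0. (H y)\<^sup>2 * deriv (\<lambda>t. deriv (deriv H) t - deriv P (H t)) y = - U) \<and>
     H 0 = 0 \<and>
     (\<forall>y>0. H y > 0) \<and>
     ((\<lambda>y. (deriv H y) ^ 3 / ln y) \<longlongrightarrow> 3 * U) at_top \<and>
     ((\<lambda>y. (deriv H y)\<^sup>2 / 2 - P (H y)) \<longlongrightarrow> \<Theta>\<^sub>0) (at_right 0)"

end

theory Submission
  imports Defs "HOL-Real_Asymp.Real_Asymp"
begin

text \<open>
  The equation loses one order when the height \<open>h = H(y)\<close> becomes the independent variable. Write
  \<open>f(h)\<close> for the slope \<open>H\<^sub>y\<close> at height \<open>h\<close> and \<open>E = f\<^sup>2/2 - P\<close>. Then \<open>E' = H\<^sub>y\<^sub>y - P'(H)\<close>,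
  so that the problem becomes
  \[ E'' = - \frac{U}{h^2 f}, \qquad f = \sqrt{2 (E + P)}, \qquad E(0^+) = \Theta_0, \]
  and the condition on \<open>H\<^sub>y\<^sup>3 / \<close>ln \<open>y\<close> at infinity forces \<open>E\<close> to be sublinear. From \<open>f\<close> the film is
  recovered by a quadrature: \<open>H\<close> is the inverse of \<open>h \<mapsto> \<integral>\<^sub>0\<^sup>h ds / f(s)\<close>.

  \<^bold>\<open>Uniqueness.\<close> The right-hand side increases with \<open>E\<close>, hence the difference \<open>w\<close> of two solutions
  satisfies \<open>w'' > 0\<close> wherever \<open>w > 0\<close>. As \<open>w\<close> vanishes at \<open>0\<close> and is sublinear, comparison with the
  lines \<open>\<eta> h + \<eta>\<close> excludes positive values (\<open>maximum_principle\<close>, \<open>solution_unique\<close>).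

  \<^bold>\<open>Existence.\<close> In the variable \<open>x = \<close>ln \<open>h\<close> the equation reads \<open>E'' - E' = - U / f\<close>, that is
  \<open>F = s + K(U / sqrt(2 F))\<close> for \<open>F = E + P\<close>, \<open>s = \<Theta>\<^sub>0 + P\<close> and a positive linear operator \<open>K\<close> (\<open>green\<close>).
  The nonlinearity is homogeneous of degree \<open>-1/2\<close> and \<open>s\<close> is positive because inf \<open>P + \<Theta>\<^sub>0 > 0\<close>; therefore
  \<open>F \<le> \<lambda> G\<close> with \<open>\<lambda> \<ge> 1\<close> implies that the image of \<open>G\<close> is at most \<open>sqrt \<lambda>\<close> times the image of \<open>F\<close>.
  The map thus halves the Thompson distance sup \<open>|ln (F / G)|\<close>, and the contraction principle applies
  on the set of functions comparable with a growth function chosen such that the map sends it to a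
  comparable function (\<open>fixed_point\<close>).

  \<^bold>\<open>Behaviour at infinity.\<close> With \<open>e = sqrt(2 E)\<close> the quantities \<open>w = e\<^sup>3 / (3 U)\<close> and \<open>z = w'\<close> satisfy
  \<open>z' = z - 1 + z\<^sup>2 / (3 w) + \<epsilon>\<close>, where \<open>\<epsilon>\<close> is exponentially small because \<open>P\<close> is bounded by a
  negative power of \<open>h\<close>. This equation is unstable, but \<open>z\<close> does not grow exponentially, so it must follow the
  slowly varying root: \<open>z = 1 - 1/(3 w) + ... = 1 - 1/(3 x) + O(\<close>ln \<open>x / x\<^sup>2)\<close>. Integrating yields
  \<open>w = x - \<close>ln \<open>x / 3 + c + O(\<close>ln \<open>x / x)\<close>, which is the claim with \<open>B = exp(c)\<close> (\<open>w_asymptotics\<close>,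
  \<open>profile_asymptotics\<close>).

  \<^bold>\<open>Behaviour at zero.\<close> There \<open>f\<^sup>2\<close> is asymptotic to \<open>2 P\<close>, so that \<open>H\<^sub>y\<close> is asymptotic to a multiple of
  \<open>H\<close> to the power \<open>(1 - m)/2\<close>; l'Hopital's rule applied to \<open>H\<close> to the power \<open>(m + 1)/2\<close>, divided by \<open>y\<close>,
  gives the stated law (\<open>H_near_0\<close>).
\<close>

section \<open>Comparison on half lines\<close>

lemma eventually_le_if_DERIV_le:
  fixes a b :: "real \<Rightarrow> real"
  assumes "\<forall>\<^sub>F x in at_top. (a has_real_derivative a' x) (at x)"
    and "\<forall>\<^sub>F x in at_top. (b has_real_derivative b' x) (at x)"
    and "\<forall>\<^sub>F x in at_top. a' x \<le> b' x"
  obtains K where "\<forall>\<^sub>F x in at_top. a x \<le> b x + K"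
proof -
  have "\<forall>\<^sub>F x in at_top. (a has_real_derivative a' x) (at x) \<and> (b has_real_derivative b' x) (at x)
      \<and> a' x \<le> b' x" using assms by (intro eventually_conj)
  then obtain X where X: "\<And>x. X \<le> x \<Longrightarrow> (a has_real_derivative a' x) (at x)"
    "\<And>x. X \<le> x \<Longrightarrow> (b has_real_derivative b' x) (at x)" "\<And>x. X \<le> x \<Longrightarrow> a' x \<le> b' x"
    unfolding eventually_at_top_linorder by blast
  have "b X - a X \<le> b x - a x" if "X \<le> x" for x
  proof (rule DERIV_nonneg_imp_nondecreasing[OF that])
    fix t assume "X \<le> t"
    then show "\<exists>d. ((\<lambda>x. b x - a x) has_real_derivative d) (at t) \<and> 0 \<le> d"
      using X(3)[of t] by (intro exI[of _ "b' t - a' t"] conjI DERIV_diff X) auto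
  qed
  then show ?thesis
    by (intro that[of "a X - b X"] eventually_at_top_linorderI[of X]) force
qed

text \<open>Integrating \<open>|y'| \<le> - G'\<close> with \<open>G \<rightarrow> 0\<close>: the functions \<open>y - G\<close> and \<open>y + G\<close> are monotone in
  opposite directions and approach each other, hence they enclose a common limit of \<open>y\<close>.\<close>

lemma converges_with_rate:
  fixes y G :: "real \<Rightarrow> real"
  assumes "\<forall>\<^sub>F x in at_top. (y has_real_derivative r x) (at x)"
    and "\<forall>\<^sub>F x in at_top. (G has_real_derivative - g x) (at x)"
    and "\<forall>\<^sub>F x in at_top. \<bar>r x\<bar> \<le> g x" and "(G \<longlongrightarrow> 0) at_top"
  obtains c where "\<forall>\<^sub>F x in at_top. \<bar>y x - c\<bar> \<le> G x" "(y \<longlongrightarrow> c) at_top"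
proof -
  have "\<forall>\<^sub>F x in at_top. (y has_real_derivative r x) (at x) \<and> (G has_real_derivative - g x) (at x)
      \<and> \<bar>r x\<bar> \<le> g x" using assms by (simp add: eventually_conj)
  then obtain X where X: "\<And>x. x \<ge> X \<Longrightarrow> (y has_real_derivative r x) (at x)"
     "\<And>x. x \<ge> X \<Longrightarrow> (G has_real_derivative - g x) (at x)" "\<And>x. x \<ge> X \<Longrightarrow> \<bar>r x\<bar> \<le> g x"
    unfolding eventually_at_top_linorder by blast
  have up: "y a - G a \<le> y b - G b" if "X \<le> a" "a \<le> b" for a b
  proof (rule DERIV_nonneg_imp_nondecreasing[OF that(2)])
    fix t assume t: "a \<le> t"
    with that have "((\<lambda>t. y t - G t) has_real_derivative r t - - g t) (at t)"
      by (intro DERIV_diff X) auto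
    then show "\<exists>d. ((\<lambda>t. y t - G t) has_real_derivative d) (at t) \<and> 0 \<le> d"
      using X(3)[of t] t that by (intro exI[of _ "r t - - g t"]) auto
  qed
  have down: "y b + G b \<le> y a + G a" if "X \<le> a" "a \<le> b" for a b
  proof (rule DERIV_nonpos_imp_nonincreasing[OF that(2)])
    fix t assume t: "a \<le> t"
    with that have "((\<lambda>t. y t + G t) has_real_derivative r t + - g t) (at t)"
      by (intro DERIV_add X) auto
    then show "\<exists>d. ((\<lambda>t. y t + G t) has_real_derivative d) (at t) \<and> d \<le> 0"
      using X(3)[of t] t that by (intro exI[of _ "r t + - g t"]) auto
  qed
  have G0: "0 \<le> G x" if "X \<le> x" for x
  proof (rule tendsto_upperbound[OF assms(4)])
    show "\<forall>\<^sub>F t in at_top. G t \<le> G x"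
      using eventually_ge_at_top[of x]
      by eventually_elim (use up down that in \<open>smt (verit, best)\<close>)
  qed simp
  define c where "c = (SUP x\<in>{X..}. y x - G x)"
  have bdd: "y x - G x \<le> y z + G z" if "X \<le> x" "X \<le> z" for x z
    using up[of x "max x z"] down[of z "max x z"] G0[of "max x z"] that by simp linarith
  have le: "y x - G x \<le> c" if "X \<le> x" for x
    unfolding c_def using that bdd[of _ X]
    by (intro cSUP_upper bdd_aboveI2[of _ _ "y X + G X"]) auto
  have ge: "c \<le> y x + G x" if "X \<le> x" for x
    unfolding c_def using that bdd by (intro cSUP_least) auto
  have ev: "\<forall>\<^sub>F x in at_top. \<bar>y x - c\<bar> \<le> G x"
    using eventually_ge_at_top[of X] by eventually_elim (use le ge in \<open>auto simp: abs_le_iff algebra_simps\<close>)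
  moreover have "(y \<longlongrightarrow> c) at_top"
    by (rule LIM_zero_cancel, rule tendsto_0_le[OF assms(4), of _ 1])
       (use ev in \<open>auto elim!: eventually_mono\<close>)
  ultimately show ?thesis using that by blast
qed

text \<open>The equation \<open>u' = u\<close> is unstable: a solution of \<open>u' \<ge> u\<close> that is positive at one point dominates
  a multiple of the exponential. In terms of monotonicity, \<open>u(x) exp(-x)\<close> is nondecreasing and hence
  below its limit \<open>0\<close>. Applied to differences with explicit functions this locates the bounded
  trajectories of an unstable equation up to any order.\<close>

lemma nonpos_if_unstable_and_subexponential:
  fixes u :: "real \<Rightarrow> real"
  assumes "\<forall>\<^sub>F x in at_top. (u has_real_derivative u' x) (at x) \<and> u x \<le> u' x"
    and "((\<lambda>x. u x * exp (- x)) \<longlongrightarrow> 0) at_top"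
  shows "\<forall>\<^sub>F x in at_top. u x \<le> 0"
proof -
  obtain X where X: "\<And>x. x \<ge> X \<Longrightarrow> (u has_real_derivative u' x) (at x)" "\<And>x. x \<ge> X \<Longrightarrow> u x \<le> u' x"
    using assms(1) unfolding eventually_at_top_linorder by blast
  have mono: "u x * exp (- x) \<le> u y * exp (- y)" if "X \<le> x" "x \<le> y" for x y
  proof (rule DERIV_nonneg_imp_nondecreasing[OF that(2)])
    fix t assume t: "x \<le> t"
    have "((\<lambda>t. u t * exp (- t)) has_real_derivative (u' t - u t) * exp (- t)) (at t)"
      using X(1)[of t] t that by (auto intro!: derivative_eq_intros simp: algebra_simps)
    then show "\<exists>d. ((\<lambda>t. u t * exp (- t)) has_real_derivative d) (at t) \<and> 0 \<le> d"
      using X(2)[of t] t that by fastforce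
  qed
  have "u x * exp (- x) \<le> 0" if "X \<le> x" for x
    using tendsto_lowerbound[OF assms(2), of "u x * exp (- x)"] mono[OF that]
    by (auto simp: eventually_at_top_linorder)
  then have "u x \<le> 0" if "X \<le> x" for x
    using that by (simp add: mult_le_0_iff)
  then show ?thesis by (auto simp: eventually_at_top_linorder)
qed

section \<open>The positive inverse of the operator mapping \<open>u\<close> to \<open>u' - u''\<close>\<close>

text \<open>The mirror image of \<open>has_integral_exp_minus_to_infinity\<close>; it bounds the part of the operator that
  integrates from \<open>-\<infinity>\<close>, that is, from the contact line.\<close>

lemma exp_has_integral_atMost:
  fixes k x :: real
  assumes "k > 0"
  shows "((\<lambda>t. exp (k * t)) has_integral exp (k * x) / k) {..x}"
proof -
  have 1: "((((\<lambda>t. exp (k * t) / k) \<circ> real_of_ereal) \<longlongrightarrow> 0) (at_right (- \<infinity>)))"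
    unfolding comp_def at_right_MInf filterlim_filtermap real_of_ereal.simps
    using assms by real_asymp
  have 2: "((((\<lambda>t. exp (k * t) / k) \<circ> real_of_ereal) \<longlongrightarrow> exp (k * x) / k) (at_left (ereal x)))"
    unfolding comp_def using assms
    by (auto simp: at_left_ereal filterlim_filtermap intro!: tendsto_eq_intros)
  have I: "set_integrable lborel (einterval (-\<infinity>) (ereal x)) (\<lambda>t. exp (k * t))"
    "(LBINT t=-\<infinity>..ereal x. exp (k * t)) = exp (k * x) / k - 0"
    by (rule interval_integral_FTC_nonneg[OF _ _ _ _ 1 2]; use assms in \<open>auto intro!: derivative_eq_intros\<close>)+
  then have "set_integrable lborel {..<x} (\<lambda>t. exp (k * t))" by simp
  moreover from I have "(LINT t:{..<x}|lborel. exp (k * t)) = exp (k * x) / k"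
    by (simp add: interval_lebesgue_integral_def)
  ultimately have "((\<lambda>t. exp (k * t)) has_integral exp (k * x) / k) {..<x}"
    using set_borel_integral_eq_integral by (metis has_integral_integral)
  moreover have n: "negligible {y \<in> {..<x} - {..x}. exp (k * y) \<noteq> 0}"
    "negligible {y \<in> {..x} - {..<x}. exp (k * y) \<noteq> 0}"
    by (rule negligible_subset[of "{x}"]; force)+
  ultimately show ?thesis
    using has_integral_spike_set_eq[OF n] by simp
qed

lemma integrable_if_continuous_bounded_by:
  fixes q g :: "real \<Rightarrow> real"
  assumes "continuous_on UNIV q" "g integrable_on S" "S \<in> sets lebesgue"
    and "\<And>x. x \<in> S \<Longrightarrow> \<bar>q x\<bar> \<le> g x"
  shows "q integrable_on S"
proof (rule measurable_bounded_by_integrable_imp_integrable)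
  show "q \<in> borel_measurable (lebesgue_on S)"
    by (rule continuous_imp_measurable_on_sets_lebesgue[OF continuous_on_subset[OF assms(1)]])
      (use assms(3) in auto)
qed (use assms in auto)

text \<open>The function \<open>green q\<close> is the integral of \<open>min(1, exp(x - t)) q(t)\<close> over all \<open>t\<close>: the solution of
  \<open>u'' - u' = - q\<close> that vanishes at \<open>-\<infinity>\<close> and grows more slowly than \<open>exp(x)\<close> at \<open>+\<infinity>\<close>. Its derivative
  is \<open>green_flux q\<close>. In the variable \<open>h = exp(x)\<close> the kernel is \<open>min(h, s) / s\<^sup>2\<close>, the Green function of
  \<open>- h\<^sup>2 u'' = q\<close> under the conditions \<open>u(0) = 0\<close> and \<open>u'(\<infinity>) = 0\<close>.\<close>

definition green_flux :: "(real \<Rightarrow> real) \<Rightarrow> real \<Rightarrow> real" where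
  "green_flux q x = exp x * integral {x..} (\<lambda>t. exp (- t) * q t)"

definition green :: "(real \<Rightarrow> real) \<Rightarrow> real \<Rightarrow> real" where
  "green q x = integral {..x} q + green_flux q x"

text \<open>An exponential \<open>exp(k x)\<close> with \<open>0 < k\<close> is integrable at \<open>-\<infinity>\<close>, and with \<open>k < 1\<close> it is integrable
  at \<open>+\<infinity>\<close> against \<open>exp(-x)\<close>; one such bound therefore makes both integrals converge, and it is
  reproduced by the operator.\<close>

locale green_source =
  fixes q :: "real \<Rightarrow> real" and C k :: real
  assumes cont: "continuous_on UNIV q"
    and nonneg: "\<And>x. 0 \<le> q x" and bound: "\<And>x. q x \<le> C * exp (k * x)"
    and k: "0 < k" "k < 1"
begin

lemma int_below: "q integrable_on {..x}"
proof (rule integrable_if_continuous_bounded_by[OF cont])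
  show "(\<lambda>t. C * exp (k * t)) integrable_on {..x}"
    using has_integral_mult_right[OF exp_has_integral_atMost[OF k(1)]] by blast
qed (use nonneg bound in auto)

lemma tail_bound_has_integral:
  "((\<lambda>t. C * exp (- (1 - k) * t)) has_integral C * (exp (- (1 - k) * x) / (1 - k))) {x..}"
  by (rule has_integral_mult_right[OF has_integral_exp_minus_to_infinity]) (use k in auto)

lemma int_above: "(\<lambda>t. exp (- t) * q t) integrable_on {x..}"
proof (rule integrable_if_continuous_bounded_by)
  show "continuous_on UNIV (\<lambda>t. exp (- t) * q t)"
    by (intro continuous_intros cont)
  show "(\<lambda>t. C * exp (- (1 - k) * t)) integrable_on {x..}"
    using tail_bound_has_integral by blast
  show "\<bar>exp (- t) * q t\<bar> \<le> C * exp (- (1 - k) * t)" for t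
  proof -
    have "exp (- t) * q t \<le> exp (- t) * (C * exp (k * t))"
      using bound[of t] by (intro mult_left_mono) auto
    also have "\<dots> = C * exp (- (1 - k) * t)" by (simp add: mult_exp_exp algebra_simps)
    finally show ?thesis using nonneg[of t] by (simp add: abs_mult)
  qed
qed auto

lemma DERIV_below: "((\<lambda>x. integral {..x} q) has_real_derivative q x) (at x)"
proof -
  have eq: "integral {..x-1} q + integral {x-1..u} q = integral {..u} q" if "u \<in> {x-1<..<x+1}" for u
  proof -
    have "integral ({..x-1} \<union> {x-1..u}) q = integral {..x-1} q + integral {x-1..u} q"
    proof (rule integral_Un[OF int_below integrable_continuous_real])
      show "negligible ({..x-1} \<inter> {x-1..u})" by (rule negligible_subset[of "{x-1}"]) auto
    qed (rule continuous_on_subset[OF cont subset_UNIV])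
    moreover have "{..x-1} \<union> {x-1..u} = {..u}" using that by auto
    ultimately show ?thesis by simp
  qed
  have "((\<lambda>u. integral {x-1..u} q) has_real_derivative q x) (at x within {x-1..x+1})"
    by (rule integral_has_real_derivative[OF continuous_on_subset[OF cont subset_UNIV]]) auto
  then have "((\<lambda>u. integral {x-1..u} q) has_real_derivative q x) (at x)"
    by (simp add: at_within_Icc_at)
  then have "((\<lambda>u. integral {..x-1} q + integral {x-1..u} q) has_real_derivative q x) (at x)"
    using DERIV_add[OF DERIV_const] by fastforce
  then show ?thesis
    by (rule has_field_derivative_transform_within_open[of _ _ _ "{x-1<..<x+1}"])
       (use eq in auto)
qed

lemma DERIV_above:
  "((\<lambda>x. integral {x..} (\<lambda>t. exp (- t) * q t)) has_real_derivative - (exp (- x) * q x)) (at x)"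
proof -
  let ?q = "\<lambda>t. exp (- t) * q t"
  have c: "continuous_on S ?q" for S
    by (intro continuous_intros continuous_on_subset[OF cont]) auto
  have eq: "integral {u..x+1} ?q + integral {x+1..} ?q = integral {u..} ?q" if "u \<in> {x-1<..<x+1}" for u
  proof -
    have "integral ({u..x+1} \<union> {x+1..}) ?q = integral {u..x+1} ?q + integral {x+1..} ?q"
    proof (rule integral_Un[OF integrable_continuous_real int_above])
      show "negligible ({u..x+1} \<inter> {x+1..})" by (rule negligible_subset[of "{x+1}"]) auto
    qed (rule c)
    moreover have "{u..x+1} \<union> {x+1..} = {u..}" using that by auto
    ultimately show ?thesis by simp
  qed
  have "((\<lambda>u. integral {u..x+1} ?q) has_real_derivative - ?q x) (at x within {x-1..x+1})"
    by (rule integral_has_real_derivative'[OF c]) auto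
  then have "((\<lambda>u. integral {u..x+1} ?q) has_real_derivative - ?q x) (at x)"
    by (simp add: at_within_Icc_at)
  then have "((\<lambda>u. integral {u..x+1} ?q + integral {x+1..} ?q) has_real_derivative - ?q x) (at x)"
    using DERIV_add[OF _ DERIV_const] by fastforce
  then show ?thesis
    by (rule has_field_derivative_transform_within_open[of _ _ _ "{x-1<..<x+1}"])
       (use eq in auto)
qed

lemma DERIV_green_flux: "(green_flux q has_real_derivative green_flux q x - q x) (at x)"
  unfolding green_flux_def
  using DERIV_mult[OF DERIV_exp DERIV_above, of x]
  by (rule DERIV_cong) (simp add: algebra_simps mult_exp_exp)

lemma DERIV_green: "(green q has_real_derivative green_flux q x) (at x)"
  unfolding green_def
  using DERIV_add[OF DERIV_below DERIV_green_flux, of x] by simp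

lemma continuous_green: "continuous_on UNIV (green q)"
  by (intro continuous_at_imp_continuous_on ballI DERIV_isCont[OF DERIV_green])

lemma below_bounds: "0 \<le> integral {..x} q" "integral {..x} q \<le> C * exp (k * x) / k"
proof -
  have "((\<lambda>t. C * exp (k * t)) has_integral C * (exp (k * x) / k)) {..x}"
    by (rule has_integral_mult_right[OF exp_has_integral_atMost[OF k(1)]])
  from has_integral_le[OF integrable_integral[OF int_below] this bound]
  show "integral {..x} q \<le> C * exp (k * x) / k" by simp
  show "0 \<le> integral {..x} q" by (rule integral_nonneg[OF int_below nonneg])
qed

lemma flux_bounds: "0 \<le> green_flux q x" "green_flux q x \<le> C * exp (k * x) / (1 - k)"
proof -
  have "integral {x..} (\<lambda>t. exp (- t) * q t) \<le> C * (exp (- (1 - k) * x) / (1 - k))"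
  proof (rule has_integral_le[OF integrable_integral[OF int_above] tail_bound_has_integral])
    fix t
    have "exp (- t) * q t \<le> exp (- t) * (C * exp (k * t))"
      using bound[of t] by (intro mult_left_mono) auto
    also have "\<dots> = C * exp (- (1 - k) * t)" by (simp add: mult_exp_exp algebra_simps)
    finally show "exp (- t) * q t \<le> C * exp (- (1 - k) * t)" .
  qed
  then have "green_flux q x \<le> exp x * (C * (exp (- (1 - k) * x) / (1 - k)))"
    unfolding green_flux_def by (intro mult_left_mono) auto
  also have "\<dots> = C * (exp x * exp (- (1 - k) * x)) / (1 - k)" by simp
  also have "exp x * exp (- (1 - k) * x) = exp (k * x)" by (simp add: mult_exp_exp algebra_simps)
  finally show "green_flux q x \<le> C * exp (k * x) / (1 - k)" by simp
  show "0 \<le> green_flux q x"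
    unfolding green_flux_def
    by (intro mult_nonneg_nonneg integral_nonneg int_above) (simp_all add: nonneg)
qed

lemma green_bounds: "0 \<le> green q x" "green q x \<le> C * (1 / k + 1 / (1 - k)) * exp (k * x)"
  using below_bounds[of x] flux_bounds[of x] by (simp_all add: green_def algebra_simps)

lemma flux_le:
  assumes "\<And>t. t \<ge> x \<Longrightarrow> q t \<le> b"
  shows "green_flux q x \<le> b"
proof -
  have h: "((\<lambda>t. exp (- 1 * t) * b) has_integral exp (- 1 * x) / 1 * b) {x..}"
    by (rule has_integral_mult_left[OF has_integral_exp_minus_to_infinity]) auto
  have "integral {x..} (\<lambda>t. exp (- t) * q t) \<le> exp (- 1 * x) / 1 * b"
    by (rule has_integral_le[OF integrable_integral[OF int_above] h]) (use assms in auto)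
  then have "green_flux q x \<le> exp x * (exp (- 1 * x) / 1 * b)"
    unfolding green_flux_def by (intro mult_left_mono) auto
  also have "\<dots> = b" by (simp add: exp_minus)
  finally show ?thesis .
qed

lemma green_ge:
  assumes "0 \<le> x" "\<And>t. 0 \<le> t \<Longrightarrow> t \<le> x \<Longrightarrow> b \<le> q t"
  shows "x * b \<le> green q x"
proof -
  have i: "q integrable_on {0..x}"
    by (intro integrable_continuous_real continuous_on_subset[OF cont]) auto
  have "((\<lambda>t. b) has_integral (x - 0) * b) {0..x}"
    using has_integral_const_real[of b 0 x] assms by simp
  from has_integral_le[OF this integrable_integral[OF i]] assms
  have "x * b \<le> integral {0..x} q" by auto
  also have "\<dots> \<le> integral {..x} q"
    by (rule integral_subset_le[OF _ i int_below]) (auto simp: nonneg)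
  also have "\<dots> \<le> green q x" using flux_bounds by (simp add: green_def)
  finally show ?thesis .
qed

text \<open>A zero of the flux would be followed by negative values, by the equation for its derivative.\<close>

lemma flux_pos:
  assumes "\<And>t. 0 < q t" shows "0 < green_flux q x"
proof (rule ccontr)
  assume "\<not> ?thesis"
  then have z: "green_flux q x = 0" using flux_bounds(1)[of x] by linarith
  obtain d where d: "d > 0" "\<And>h. 0 < h \<Longrightarrow> h < d \<Longrightarrow> green_flux q (x + h) < green_flux q x"
    using DERIV_neg_dec_right[OF DERIV_green_flux[of x]] z assms[of x] by auto
  from d(2)[of "d/2"] d(1) z flux_bounds(1)[of "x + d/2"] show False by simp
qed

end

lemma green_scaled_mono:
  assumes "green_source q C k" "green_source r C' k'" "\<And>x. q x \<le> c * r x"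
  shows "green q x \<le> c * green r x"
proof -
  interpret q: green_source q C k by fact
  interpret r: green_source r C' k' by fact
  have "integral {..x} q \<le> c * integral {..x} r"
    by (rule has_integral_le[OF integrable_integral[OF q.int_below]
          has_integral_mult_right[OF integrable_integral[OF r.int_below]] assms(3)])
  moreover have "integral {x..} (\<lambda>t. exp (- t) * q t) \<le> c * integral {x..} (\<lambda>t. exp (- t) * r t)"
    by (rule has_integral_le[OF integrable_integral[OF q.int_above]
          has_integral_mult_right[OF integrable_integral[OF r.int_above]]])
      (use assms(3) in \<open>auto simp: mult.left_commute[of c]\<close>)
  then have "exp x * integral {x..} (\<lambda>t. exp (- t) * q t)
      \<le> exp x * (c * integral {x..} (\<lambda>t. exp (- t) * r t))"
    by (intro mult_left_mono) auto
  ultimately show ?thesis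
    unfolding green_def green_flux_def distrib_left mult.left_commute[of c "exp x"]
    by (rule add_mono)
qed

section \<open>A fixed point by contraction in the Thompson metric\<close>

definition source :: "real \<Rightarrow> (real \<Rightarrow> real) \<Rightarrow> real \<Rightarrow> real" where
  "source U F t = U / sqrt (2 * F t)"

lemma source_antimono:
  assumes "U > 0" "r > 0" "\<And>t. 0 < F t" "\<And>t. 0 < G t" "\<And>t. F t \<le> r * G t"
  shows "source U G t \<le> sqrt r * source U F t"
proof -
  have "sqrt (2 * F t) \<le> sqrt (r * (2 * G t))"
    using assms(5)[of t] by simp
  then have "sqrt (2 * F t) \<le> sqrt r * sqrt (2 * G t)" by (simp only: real_sqrt_mult)
  then have "U * sqrt (2 * F t) \<le> U * (sqrt r * sqrt (2 * G t))"
    using assms(1) by (intro mult_left_mono) auto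
  then show ?thesis
    using assms(3)[of t] assms(4)[of t] by (simp add: source_def field_simps)
qed

text \<open>Here \<open>s\<close> stands for \<open>\<Theta>\<^sub>0 + P(exp x)\<close>. The lower bound by \<open>exp(- 2 k x)\<close> expresses the singularity of
  \<open>P\<close> at zero height and makes \<open>U / sqrt(2 s)\<close> admissible as a source.\<close>

locale green_fixed_point =
  fixes s :: "real \<Rightarrow> real" and U \<delta> M c k :: real
  assumes s_cont: "continuous_on UNIV s" and s_ge: "\<And>x. \<delta> \<le> s x"
    and U: "U > 0" and \<delta>: "\<delta> > 0" and k: "0 < k" "k < 1" and c: "0 < c"
    and s_exp: "\<And>x. c * exp (- 2 * k * x) \<le> s x"
    and s_le: "\<And>x. x \<ge> 0 \<Longrightarrow> s x \<le> M"
begin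

text \<open>The expected size of the solution: \<open>s\<close> dominates near the contact line, and far away
  \<open>F\<close> behaves as \<open>H\<^sub>y\<^sup>2 / 2\<close>, which grows as \<open>x\<close> to the power \<open>2/3\<close> because \<open>H\<^sub>y\<^sup>3\<close> grows as \<open>3 U x\<close>.\<close>

definition growth :: "real \<Rightarrow> real" where
  "growth x = s x + (1 + max 0 x) powr (2 / 3)"

lemma s_pos: "0 < s x"
  using s_ge[of x] \<delta> by linarith

lemma growth_ge: "s x \<le> growth x" "(1 + max 0 x) powr (2 / 3) \<le> growth x"
  using s_pos[of x] by (auto simp: growth_def)

lemma growth_pos: "0 < growth x"
  using growth_ge s_pos less_le_trans by blast

lemma growth_cont: "continuous_on UNIV growth"
  unfolding growth_def
  by (intro continuous_intros s_cont) auto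

lemma green_source_source:
  assumes "continuous_on UNIV F" "a > 0" "\<And>t. a * growth t \<le> F t"
  shows "green_source (source U F) (U / sqrt (2 * (a * c))) k"
proof
  have Fpos: "0 < F t" for t
    using assms(2) assms(3)[of t] growth_pos[of t] by (meson less_le_trans mult_pos_pos)
  show "continuous_on UNIV (source U F)"
    unfolding source_def
    by (intro continuous_intros assms(1)) (metis Fpos less_numeral_extra(3) mult_eq_0_iff real_sqrt_eq_zero_cancel_iff zero_neq_numeral)
  show "0 \<le> source U F t" for t
    using U Fpos[of t] by (simp add: source_def)
  show "source U F t \<le> U / sqrt (2 * (a * c)) * exp (k * t)" for t
  proof -
    have "a * (c * exp (- 2 * k * t)) \<le> a * growth t"
      using s_exp[of t] growth_ge(1)[of t] assms(2) by (intro mult_left_mono) auto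
    also have "\<dots> \<le> F t" by (rule assms)
    finally have *: "a * (c * exp (- 2 * k * t)) \<le> F t" .
    have "exp (- 2 * k * t) = (exp (- (k * t)))\<^sup>2"
      by (simp add: power2_eq_square mult_exp_exp)
    with * have "sqrt (2 * (a * c) * (exp (- (k * t)))\<^sup>2) \<le> sqrt (2 * F t)"
      by (intro real_sqrt_le_mono) (simp add: mult.assoc)
    then have "sqrt (2 * (a * c)) * exp (- (k * t)) \<le> sqrt (2 * F t)"
      by (simp only: real_sqrt_mult real_sqrt_power) simp
    then have "U / sqrt (2 * F t) \<le> U / (sqrt (2 * (a * c)) * exp (- (k * t)))"
      using U assms(2) c by (intro divide_left_mono) (auto simp: Fpos intro!: mult_pos_pos)
    then show ?thesis by (simp add: source_def exp_minus field_simps)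
  qed
  show "0 < k" "k < 1" by (rule k)+
qed

definition step :: "(real \<Rightarrow> real) \<Rightarrow> real \<Rightarrow> real" where
  "step F x = s x + green (source U F) x"

text \<open>The domain of the map. A bound from above is carried separately, by the logarithm of the ratio
  to \<open>growth\<close> being bounded.\<close>

definition dominates_growth :: "(real \<Rightarrow> real) \<Rightarrow> bool" where
  "dominates_growth F \<longleftrightarrow> continuous_on UNIV F \<and> (\<exists>a>0. \<forall>t. a * growth t \<le> F t)"

lemma dominating_source:
  assumes "dominates_growth F" obtains D where "green_source (source U F) D k"
  using assms green_source_source unfolding dominates_growth_def by blast

lemma dominating_pos:
  assumes "dominates_growth F" shows "0 < F t"
proof -
  obtain a where "a > 0" "\<forall>t. a * growth t \<le> F t" using assms unfolding dominates_growth_def by blast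
  then show ?thesis using growth_pos[of t] by (meson less_le_trans mult_pos_pos)
qed

text \<open>The heart of the existence proof. The source has degree \<open>-1/2\<close>, which turns the factor \<open>r\<close> into
  \<open>sqrt r\<close>; the inhomogeneity \<open>s\<close> is positive, so multiplying it by \<open>sqrt r \<ge> 1\<close> only helps.\<close>

lemma step_contracts:
  assumes "dominates_growth F" "dominates_growth G" "1 \<le> r" "\<And>t. F t \<le> r * G t"
  shows "step G x \<le> sqrt r * step F x"
proof -
  obtain D1 where 1: "green_source (source U F) D1 k" using dominating_source[OF assms(1)] .
  obtain D2 where 2: "green_source (source U G) D2 k" using dominating_source[OF assms(2)] .
  have "source U G t \<le> sqrt r * source U F t" for t
    by (rule source_antimono[OF U _ dominating_pos[OF assms(1)] dominating_pos[OF assms(2)]])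
      (use assms in auto)
  from green_scaled_mono[OF 2 1 this]
  have "green (source U G) x \<le> sqrt r * green (source U F) x" .
  moreover have "s x \<le> sqrt r * s x"
    using assms(3) s_pos[of x] by simp
  ultimately show ?thesis by (simp add: step_def algebra_simps)
qed

lemma step_cont: "dominates_growth F \<Longrightarrow> continuous_on UNIV (step F)"
  unfolding step_def
  by (metis continuous_on_add green_source.continuous_green dominating_source s_cont)

lemma step_ge: "dominates_growth F \<Longrightarrow> s x \<le> step F x"
  unfolding step_def using green_source.green_bounds(1) dominating_source
  by (metis le_add_same_cancel1)

lemma growth_dominates: "dominates_growth growth"
  unfolding dominates_growth_def by (auto intro: growth_cont exI[of _ 1])

text \<open>Far away the source is at most a multiple of \<open>(1 + x)\<close> to the power \<open>-1/3\<close>, and so is the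
  derivative of its image; the integral of this power is a multiple of \<open>(1 + x)\<close> to the power \<open>2/3\<close>.\<close>

lemma step_growth_le: "\<exists>C1>0. \<forall>x. step growth x \<le> C1 * growth x"
proof -
  define D where "D = U / sqrt (2 * (1 * c))"
  interpret green_source "source U growth" D k
    unfolding D_def by (rule green_source_source) (auto simp: growth_cont)
  define E where "E = D * (1 / k + 1 / (1 - k))"
  have D: "D > 0" using U c by (simp add: D_def)
  have E: "E > 0" using D k unfolding E_def by (intro mult_pos_pos add_pos_pos) auto
  have neg: "green (source U growth) x \<le> E" if "x \<le> 0" for x
  proof -
    have "green (source U growth) x \<le> E * exp (k * x)"
      using green_bounds(2)[of x] by (simp add: E_def)
    also have "exp (k * x) \<le> 1" using that k by (simp add: mult_nonneg_nonpos)
    then have "E * exp (k * x) \<le> E" using E by simp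
    finally show ?thesis .
  qed
  have flux: "green_flux (source U growth) x \<le> U * (1 + x) powr (- 1 / 3)" if "x \<ge> 0" for x
  proof (rule flux_le)
    fix t assume t: "t \<ge> x"
    have "((1 + x) powr (1 / 3))\<^sup>2 = (1 + x) powr (2 / 3)"
      using that by (simp add: power2_eq_square flip: powr_add)
    also have "\<dots> \<le> (1 + t) powr (2 / 3)"
      using that t by (intro powr_mono2) auto
    also have "\<dots> \<le> growth t" using growth_ge(2)[of t] that t by simp
    also have "\<dots> \<le> 2 * growth t" using growth_pos[of t] by simp
    finally have "(1 + x) powr (1 / 3) \<le> sqrt (2 * growth t)" by (rule real_le_rsqrt)
    then have "U / sqrt (2 * growth t) \<le> U / (1 + x) powr (1 / 3)"
      using U that growth_pos[of t] by (intro divide_left_mono) auto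
    then show "source U growth t \<le> U * (1 + x) powr (- 1 / 3)"
      using that by (simp add: source_def powr_minus_divide)
  qed
  have pos: "green (source U growth) x \<le> E + 3 / 2 * U * (1 + x) powr (2 / 3)" if x: "x \<ge> 0" for x
  proof -
    have "3 / 2 * U * (1 + 0) powr (2 / 3) - green (source U growth) 0
        \<le> 3 / 2 * U * (1 + x) powr (2 / 3) - green (source U growth) x"
    proof (rule DERIV_nonneg_imp_nondecreasing[OF x])
      fix y :: real assume y: "0 \<le> y"
      have "((\<lambda>x. 3 / 2 * U * (1 + x) powr (2 / 3) - green (source U growth) x) has_real_derivative
          U * (1 + y) powr (- 1 / 3) - green_flux (source U growth) y) (at y)"
        using y by (auto intro!: derivative_eq_intros DERIV_green)
      then show "\<exists>z. ((\<lambda>x. 3 / 2 * U * (1 + x) powr (2 / 3) - green (source U growth) x)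
          has_real_derivative z) (at y) \<and> 0 \<le> z"
        using flux[OF y] by (intro exI conjI) auto
    qed
    then show ?thesis using neg[of 0] U by simp
  qed
  have "step growth x \<le> (1 + E / \<delta> + 3 / 2 * U) * growth x" for x
  proof -
    have "E = (E / \<delta>) * \<delta>" using \<delta> by simp
    also have "\<dots> \<le> (E / \<delta>) * growth x"
      using s_ge[of x] growth_ge(1)[of x] E \<delta> by (intro mult_left_mono) auto
    finally have 1: "E \<le> (E / \<delta>) * growth x" .
    have "3 / 2 * U * (1 + max 0 x) powr (2 / 3) \<le> 3 / 2 * U * growth x"
      using growth_ge(2)[of x] U by (intro mult_left_mono) auto
    moreover have "green (source U growth) x \<le> E + 3 / 2 * U * (1 + max 0 x) powr (2 / 3)"
    proof (cases "x \<ge> 0")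
      case False
      with neg[of x] U show ?thesis by simp
    qed (use pos in auto)
    ultimately show ?thesis using 1 growth_ge(1)[of x]
      by (simp add: step_def algebra_simps)
  qed
  moreover have "1 + E / \<delta> + 3 / 2 * U > 0" using E \<delta> U by (simp add: add_pos_pos)
  ultimately show ?thesis by blast
qed

text \<open>Beyond \<open>x = 1\<close> the source on \<open>[0, x]\<close> is at least a multiple of \<open>1 / l\<close> with \<open>l\<^sup>3 = 1 + x\<close>, hence its
  image at \<open>x\<close> is at least a multiple of \<open>x / l\<close>, which is comparable with \<open>l\<^sup>2\<close>. For smaller \<open>x\<close> the
  term \<open>s \<ge> \<delta>\<close> suffices.\<close>

lemma step_growth_ge: "\<exists>c1>0. \<forall>x. c1 * growth x \<le> step growth x"
proof -
  interpret green_source "source U growth" "U / sqrt (2 * (1 * c))" k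
    by (rule green_source_source) (auto simp: growth_cont)
  define b where "b = U / sqrt (2 * (M + 1))"
  have M: "M > 0" using s_le[of 0] s_pos[of 0] by simp
  have b: "b > 0" using U M by (simp add: b_def)
  define c' where "c' = min (\<delta> / 2) (b / 2)"
  have c': "c' > 0" using \<delta> b by (simp add: c'_def)
  have key: "c' * (1 + max 0 x) powr (2 / 3) \<le> step growth x" for x
  proof (cases "x \<le> 1")
    case True
    have "(1 + max 0 x) powr (2 / 3) \<le> 2 powr (2 / 3)"
      using True by (intro powr_mono2) auto
    also have "\<dots> \<le> 2 powr (1::real)" by (intro powr_mono) auto
    finally have "c' * (1 + max 0 x) powr (2 / 3) \<le> (\<delta> / 2) * 2"
      using \<delta> b by (intro mult_mono) (auto simp: c'_def)
    also have "\<dots> \<le> step growth x"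
      using s_ge[of x] step_ge[OF growth_dominates, of x] by simp
    finally show ?thesis .
  next
    case False
    define l where "l = (1 + x) powr (1 / 3)"
    have l: "l \<ge> 1" using False by (auto simp: l_def intro: ge_one_powr_ge_zero)
    have l2: "(1 + x) powr (2 / 3) = l\<^sup>2" and l3: "l ^ 3 = 1 + x"
      using False by (auto simp: l_def power2_eq_square powr_power simp flip: powr_add)
    have "x * (b / l) \<le> green (source U growth) x"
    proof (rule green_ge)
      fix t assume t: "0 \<le> t" "t \<le> x"
      have "(1 + t) powr (2 / 3) \<le> l\<^sup>2"
        using t unfolding l2[symmetric] by (intro powr_mono2) auto
      then have "growth t \<le> M + l\<^sup>2" using s_le[of t] t by (simp add: growth_def)
      also have "\<dots> \<le> (M + 1) * l\<^sup>2" using M l by (simp add: algebra_simps)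
      finally have "sqrt (2 * growth t) \<le> sqrt (2 * (M + 1) * l\<^sup>2)"
        unfolding real_sqrt_le_iff by linarith
      also have "\<dots> = sqrt (2 * (M + 1)) * l" using l by (simp add: real_sqrt_mult)
      finally have "U / (sqrt (2 * (M + 1)) * l) \<le> U / sqrt (2 * growth t)"
        using U growth_pos[of t] l M by (intro divide_left_mono) (auto intro!: mult_pos_pos)
      then show "b / l \<le> source U growth t" by (simp add: b_def source_def)
    qed (use False in auto)
    moreover have "(b / 2) * l\<^sup>2 \<le> x * (b / l)"
    proof -
      have "l ^ 3 \<le> 2 * x" using False l3 by simp
      then have "b * l ^ 3 \<le> b * (2 * x)" using b by (intro mult_left_mono) auto
      then show ?thesis using l by (simp add: field_simps power2_eq_square power3_eq_cube)
    qed
    moreover have "c' * l\<^sup>2 \<le> (b / 2) * l\<^sup>2" by (intro mult_right_mono) (auto simp: c'_def)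
    ultimately have "c' * l\<^sup>2 \<le> step growth x"
      using s_pos[of x] unfolding step_def by linarith
    then show ?thesis using False l2 by simp
  qed
  have "min 1 c' / 2 * growth x \<le> step growth x" for x
  proof -
    have "min 1 c' * s x \<le> s x" using s_pos[of x] mult_right_mono[of "min 1 c'" 1 "s x"] by auto
    moreover have "min 1 c' * (1 + max 0 x) powr (2 / 3) \<le> c' * (1 + max 0 x) powr (2 / 3)"
      by (intro mult_right_mono) auto
    ultimately show ?thesis
      using key[of x] step_ge[OF growth_dominates, of x] by (simp add: growth_def algebra_simps)
  qed
  moreover have "min 1 c' / 2 > 0" using c' by simp
  ultimately show ?thesis by blast
qed

text \<open>The map in the coordinate \<open>\<phi> = \<close>ln \<open>(F / growth)\<close>. The Thompson distance becomes the supremum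
  distance, so the iteration takes place in the Banach space of bounded continuous functions.\<close>

definition lift_step :: "(real \<Rightarrow>\<^sub>C real) \<Rightarrow> real \<Rightarrow> real" where
  "lift_step \<phi> x = ln (step (\<lambda>t. exp (\<phi> t) * growth t) x / growth x)"

lemma exp_growth_dominates: "dominates_growth (\<lambda>t. exp (apply_bcontfun \<phi> t) * growth t)"
proof -
  obtain B where B: "\<And>t. \<bar>apply_bcontfun \<phi> t\<bar> \<le> B"
    using bounded_apply_bcontfun[of \<phi>] by (auto simp: bounded_iff)
  have "exp (- B) * growth t \<le> exp (apply_bcontfun \<phi> t) * growth t" for t
    using B[of t] growth_pos[of t] by (intro mult_right_mono) auto
  then show ?thesis
    unfolding dominates_growth_def
    by (intro conjI continuous_intros growth_cont exI[of _ "exp (- B)"]) auto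
qed

lemma lift_step_le:
  assumes "\<And>t. apply_bcontfun \<phi> t \<le> apply_bcontfun \<psi> t + R" "R \<ge> 0"
  shows "lift_step \<psi> x \<le> lift_step \<phi> x + R / 2"
proof -
  let ?F = "\<lambda>\<phi> t. exp (apply_bcontfun \<phi> t) * growth t"
  have "step (?F \<psi>) x \<le> sqrt (exp R) * step (?F \<phi>) x"
  proof (rule step_contracts)
    fix t
    have "exp (apply_bcontfun \<phi> t) \<le> exp R * exp (apply_bcontfun \<psi> t)"
      using assms(1)[of t] by (simp add: mult_exp_exp add.commute)
    then show "exp (apply_bcontfun \<phi> t) * growth t \<le> exp R * (exp (apply_bcontfun \<psi> t) * growth t)"
      using growth_pos[of t] by (simp flip: mult.assoc)
  qed (use assms in \<open>auto simp: exp_growth_dominates\<close>)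
  also have "sqrt (exp R) = exp (R / 2)"
    by (rule real_sqrt_unique) (auto simp: power2_eq_square mult_exp_exp)
  finally have "step (?F \<psi>) x / growth x \<le> exp (R / 2) * (step (?F \<phi>) x / growth x)"
    using growth_pos[of x] by (simp add: divide_right_mono)
  moreover have p: "0 < step (?F \<theta>) x / growth x" for \<theta>
    using step_ge[OF exp_growth_dominates, of x \<theta>] s_pos[of x] growth_pos[of x] by simp
  ultimately have "ln (step (?F \<psi>) x / growth x) \<le> ln (exp (R / 2) * (step (?F \<phi>) x / growth x))"
    using mult_pos_pos[OF exp_gt_zero p[of \<phi>]] by (subst ln_le_cancel_iff) auto
  also have "\<dots> = R / 2 + ln (step (?F \<phi>) x / growth x)"
    using p[of \<phi>] by (subst ln_mult_pos) auto
  finally show ?thesis by (simp add: lift_step_def)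
qed

text \<open>By the contraction estimate it suffices to bound the image of a single function; \<open>growth\<close> itself,
  that is \<open>\<phi> = 0\<close>, is comparable with its image.\<close>

lemma lift_step_bcontfun: "lift_step \<phi> \<in> bcontfun"
  unfolding bcontfun_def
proof (intro CollectI conjI)
  have p: "0 < step (\<lambda>t. exp (apply_bcontfun \<phi> t) * growth t) x" for x \<phi>
    using step_ge[OF exp_growth_dominates, of x \<phi>] s_pos[of x] by simp
  show "continuous_on UNIV (lift_step \<phi>)"
    unfolding lift_step_def
    using p growth_pos
    by (intro continuous_intros step_cont exp_growth_dominates growth_cont)
       (auto simp: less_imp_neq[symmetric])
  obtain B where B: "\<And>t. \<bar>apply_bcontfun \<phi> t\<bar> \<le> B"
    using bounded_apply_bcontfun[of \<phi>] by (auto simp: bounded_iff)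
  have B0: "B \<ge> 0" using B[of 0] by linarith
  have h: "lift_step 0 x = ln (step growth x / growth x)" for x
    by (simp add: lift_step_def)
  have pg: "0 < step growth x / growth x" for x
    using p[of 0 x] growth_pos[of x] by simp
  obtain C1 c1 where C1: "C1 > 0" "\<And>x. step growth x \<le> C1 * growth x"
    and c1: "c1 > 0" "\<And>x. c1 * growth x \<le> step growth x"
    using step_growth_le step_growth_ge by blast
  have "\<bar>lift_step \<phi> x\<bar> \<le> B / 2 + \<bar>ln C1\<bar> + \<bar>ln c1\<bar>" for x
  proof -
    have "0 \<le> apply_bcontfun \<phi> t + B" "apply_bcontfun \<phi> t \<le> B" for t
      using B[of t] by linarith+
    then have "lift_step \<phi> x \<le> lift_step 0 x + B / 2" "lift_step 0 x \<le> lift_step \<phi> x + B / 2"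
      by (intro lift_step_le; simp add: B0)+
    moreover have "ln (step growth x / growth x) \<le> ln C1"
      using C1(2)[of x] growth_pos[of x] pg[of x] C1(1)
      by (subst ln_le_cancel_iff) (auto simp: divide_le_eq)
    moreover have "ln c1 \<le> ln (step growth x / growth x)"
      using c1(2)[of x] growth_pos[of x] pg[of x] c1(1)
      by (subst ln_le_cancel_iff) (auto simp: le_divide_eq)
    ultimately show ?thesis unfolding h by linarith
  qed
  then show "bounded (range (lift_step \<phi>))"
    unfolding bounded_iff by (auto intro!: exI[of _ "B / 2 + \<bar>ln C1\<bar> + \<bar>ln c1\<bar>"])
qed

lemma fixed_point:
  obtains F where "\<And>x. s x \<le> F x"
    "\<And>x. F x = s x + green (source U F) x" "dominates_growth F"
proof -
  define T where "T \<phi> = Bcontfun (lift_step \<phi>)" for \<phi>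
  have T: "apply_bcontfun (T \<phi>) = lift_step \<phi>" for \<phi>
    unfolding T_def by (rule Bcontfun_inverse[OF lift_step_bcontfun])
  have "dist (T \<phi>) (T \<psi>) \<le> 1 / 2 * dist \<phi> \<psi>" for \<phi> \<psi>
  proof (rule dist_bound)
    fix x
    have d: "\<bar>apply_bcontfun \<phi> t - apply_bcontfun \<psi> t\<bar> \<le> dist \<phi> \<psi>" for t
      using dist_bounded[of \<phi> t \<psi>] by (simp add: dist_real_def)
    have "lift_step \<psi> x \<le> lift_step \<phi> x + dist \<phi> \<psi> / 2"
      by (rule lift_step_le) (use d in \<open>auto simp: abs_le_iff algebra_simps\<close>)
    moreover have "lift_step \<phi> x \<le> lift_step \<psi> x + dist \<phi> \<psi> / 2"
      by (rule lift_step_le) (use d in \<open>auto simp: abs_le_iff algebra_simps\<close>)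
    ultimately show "dist (apply_bcontfun (T \<phi>) x) (apply_bcontfun (T \<psi>) x) \<le> 1 / 2 * dist \<phi> \<psi>"
      unfolding T dist_real_def by linarith
  qed
  then obtain \<phi> where \<phi>: "T \<phi> = \<phi>"
    using banach_fix_type[of "1 / 2" T] by (auto dest: ex1_implies_ex)
  define F where "F = (\<lambda>t. exp (apply_bcontfun \<phi> t) * growth t)"
  have F: "dominates_growth F" unfolding F_def by (rule exp_growth_dominates)
  have fx: "step F x = F x" for x
  proof -
    have "0 < step F x / growth x" using step_ge[OF F, of x] s_pos[of x] growth_pos[of x] by simp
    moreover have "lift_step \<phi> x = apply_bcontfun \<phi> x"
      using fun_cong[OF T[of \<phi>], of x] unfolding \<phi> by (rule sym)
    then have "ln (step F x / growth x) = apply_bcontfun \<phi> x"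
      unfolding lift_step_def F_def .
    ultimately have "step F x / growth x = exp (apply_bcontfun \<phi> x)" by (metis exp_ln)
    then show ?thesis using growth_pos[of x] by (simp add: F_def field_simps)
  qed
  show ?thesis
  proof (rule that[of F])
    show "s x \<le> F x" for x using step_ge[OF F, of x] fx by simp
    show "F x = s x + green (source U F) x" for x using fx[of x] by (simp add: step_def)
  qed (rule F)
qed

text \<open>The integral equation turned back into a differential equation for the energy \<open>E\<close> and its
  derivative \<open>v\<close>, shifted so that \<open>E\<close> vanishes at the contact line.\<close>

lemma profile_exists:
  obtains E v D where
    "\<And>x. (E has_real_derivative v x) (at x)"
    "\<And>x. (v has_real_derivative v x - U / sqrt (2 * (s x + E x))) (at x)"
    "\<And>x. 0 < v x" "\<And>x. v x \<le> D" "\<And>x. 0 \<le> E x" "(E \<longlongrightarrow> 0) at_bot"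
proof -
  obtain F where F: "\<And>x. s x \<le> F x"
    "\<And>x. F x = s x + green (source U F) x" "dominates_growth F"
    using fixed_point by blast
  let ?E = "green (source U F)" and ?v = "green_flux (source U F)"
  obtain C where "green_source (source U F) C k" using dominating_source[OF F(3)] .
  then interpret green_source "source U F" C k .
  have Fpos: "0 < F x" for x by (rule dominating_pos[OF F(3)])
  have "source U F t = U / sqrt (2 * (s t + ?E t))" for t
    using F(2)[of t] by (simp only: source_def)
  then have "(?v has_real_derivative ?v x - U / sqrt (2 * (s x + ?E x))) (at x)" for x
    using DERIV_green_flux[of x] by simp
  moreover have "0 < ?v x" for x
    by (rule flux_pos) (use U Fpos in \<open>simp add: source_def\<close>)
  moreover have "?v x \<le> U / sqrt (2 * \<delta>)" for x
  proof (rule flux_le)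
    fix t
    have "\<delta> \<le> F t" using s_ge[of t] F(1)[of t] by linarith
    then show "source U F t \<le> U / sqrt (2 * \<delta>)"
      unfolding source_def using U \<delta> Fpos[of t] by (intro divide_left_mono) auto
  qed
  moreover have "(?E \<longlongrightarrow> 0) at_bot"
  proof (rule tendsto_sandwich[OF always_eventually always_eventually tendsto_const])
    show "((\<lambda>x. C * (1 / k + 1 / (1 - k)) * exp (k * x)) \<longlongrightarrow> 0) at_bot"
    proof (rule tendsto_mult_right_zero)
      show "((\<lambda>x. exp (k * x)) \<longlongrightarrow> 0) at_bot" using k by real_asymp
    qed
  qed (use green_bounds in auto)
  ultimately show ?thesis using that[OF DERIV_green] green_bounds(1) by blast
qed

end

section \<open>The expansion at infinity\<close>

text \<open>The equation for \<open>w = e\<^sup>3 / (3 U)\<close> and \<open>z = w'\<close>. Its linearization is \<open>z' = z - 1\<close>, whose only solution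
  without exponential growth is \<open>z = 1\<close>; the feedback \<open>z\<^sup>2 / (3 w)\<close> produces the logarithmic
  correction. The numerical constants in the estimates below are convenient, not optimal.\<close>

locale velocity_equation =
  fixes w z \<epsilon> :: "real \<Rightarrow> real" and C \<kappa> :: real
  assumes DERIV_w: "\<And>x. (w has_real_derivative z x) (at x)"
    and DERIV_z: "\<And>x. (z has_real_derivative z x - 1 + (z x)\<^sup>2 / (3 * w x) + \<epsilon> x) (at x)"
    and w_pos: "\<And>x. 0 < w x" and z_pos: "\<And>x. 0 < z x"
    and \<epsilon>: "\<And>x. x \<ge> 0 \<Longrightarrow> \<bar>\<epsilon> x\<bar> \<le> C * exp (- \<kappa> * x)" and \<kappa>: "\<kappa> > 0"
    and z_sub: "((\<lambda>x. z x * exp (- x)) \<longlongrightarrow> 0) at_top"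
    and w_lim: "filterlim w at_top at_top"
begin

lemma C: "0 \<le> C"
  using \<epsilon>[of 0] by simp

text \<open>The feedback is nonnegative and pushes \<open>z\<close> away from values above \<open>1\<close>.\<close>

lemma z_upper: "\<forall>\<^sub>F x in at_top. z x \<le> 1 + C * exp (- \<kappa> * x)"
proof -
  have "\<forall>\<^sub>F x in at_top. z x - 1 - C * exp (- \<kappa> * x) \<le> 0"
  proof (rule nonpos_if_unstable_and_subexponential)
    show "((\<lambda>x. (z x - 1 - C * exp (- \<kappa> * x)) * exp (- x)) \<longlongrightarrow> 0) at_top"
    proof -
      have "((\<lambda>x. z x * exp (- x) - (1 + C * exp (- \<kappa> * x)) * exp (- x)) \<longlongrightarrow> 0 - 0) at_top"
      proof (rule tendsto_diff[OF z_sub])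
        show "((\<lambda>x. (1 + C * exp (- \<kappa> * x)) * exp (- x)) \<longlongrightarrow> 0) at_top"
          using \<kappa> by real_asymp
      qed
      then show ?thesis by (simp add: algebra_simps)
    qed
    show "\<forall>\<^sub>F x in at_top. ((\<lambda>x. z x - 1 - C * exp (- \<kappa> * x)) has_real_derivative
        z x - 1 + (z x)\<^sup>2 / (3 * w x) + \<epsilon> x + C * \<kappa> * exp (- \<kappa> * x)) (at x) \<and>
        z x - 1 - C * exp (- \<kappa> * x) \<le> z x - 1 + (z x)\<^sup>2 / (3 * w x) + \<epsilon> x + C * \<kappa> * exp (- \<kappa> * x)"
      using eventually_ge_at_top[of 0]
    proof eventually_elim
      fix x :: real assume x: "0 \<le> x"
      have "0 \<le> (z x)\<^sup>2 / (3 * w x)" using w_pos[of x] by simp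
      moreover have "0 \<le> C * \<kappa> * exp (- \<kappa> * x)" using C \<kappa> by simp
      ultimately show "((\<lambda>x. z x - 1 - C * exp (- \<kappa> * x)) has_real_derivative
        z x - 1 + (z x)\<^sup>2 / (3 * w x) + \<epsilon> x + C * \<kappa> * exp (- \<kappa> * x)) (at x) \<and>
        z x - 1 - C * exp (- \<kappa> * x) \<le> z x - 1 + (z x)\<^sup>2 / (3 * w x) + \<epsilon> x + C * \<kappa> * exp (- \<kappa> * x)"
        using \<epsilon>[OF x] by (auto intro!: derivative_eq_intros DERIV_z)
    qed
  qed
  then show ?thesis by eventually_elim simp
qed

lemma z_le_2: "\<forall>\<^sub>F x in at_top. z x \<le> 2"
proof -
  have "\<forall>\<^sub>F x in at_top. C * exp (- \<kappa> * x) < 1"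
    by (rule order_tendstoD(2)[of _ 0]) (use \<kappa> in real_asymp, simp)
  with z_upper show ?thesis by eventually_elim simp
qed

text \<open>A subsolution \<open>b\<close> of subexponential size lies below \<open>z\<close>. It is used first with a constant, then
  with \<open>1 - 7 / x\<close>: every improvement of the bound on \<open>w\<close> improves the bound on the feedback.\<close>

lemma z_lower_if:
  assumes b: "\<forall>\<^sub>F x in at_top. (b has_real_derivative b' x) (at x)"
    and "\<forall>\<^sub>F x in at_top. (z x)\<^sup>2 / (3 * w x) + \<bar>\<epsilon> x\<bar> \<le> 1 - b x + b' x"
    and sub: "((\<lambda>x. b x * exp (- x)) \<longlongrightarrow> 0) at_top"
  shows "\<forall>\<^sub>F x in at_top. b x \<le> z x"
proof -
  have "\<forall>\<^sub>F x in at_top. b x - z x \<le> 0"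
  proof (rule nonpos_if_unstable_and_subexponential)
    show "((\<lambda>x. (b x - z x) * exp (- x)) \<longlongrightarrow> 0) at_top"
      using tendsto_diff[OF sub z_sub] by (simp add: algebra_simps)
    show "\<forall>\<^sub>F x in at_top. ((\<lambda>x. b x - z x) has_real_derivative
        b' x - (z x - 1 + (z x)\<^sup>2 / (3 * w x) + \<epsilon> x)) (at x) \<and>
        b x - z x \<le> b' x - (z x - 1 + (z x)\<^sup>2 / (3 * w x) + \<epsilon> x)"
      using assms(1,2)
    proof eventually_elim
      case (elim x)
      then show ?case by (auto intro!: DERIV_diff DERIV_z)
    qed
  qed
  then show ?thesis by eventually_elim simp
qed

lemma \<epsilon>_le: assumes "((\<lambda>x. exp (- \<kappa> * x) / g x) \<longlongrightarrow> 0) at_top" "\<forall>\<^sub>F x in at_top. 0 < g x"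
  shows "\<forall>\<^sub>F x in at_top. \<bar>\<epsilon> x\<bar> \<le> g x"
proof -
  have "((\<lambda>x. C * (exp (- \<kappa> * x) / g x)) \<longlongrightarrow> 0) at_top"
    by (rule tendsto_mult_right_zero[OF assms(1)])
  then have "\<forall>\<^sub>F x in at_top. C * (exp (- \<kappa> * x) / g x) < 1"
    by (rule order_tendstoD(2)) simp
  with assms(2) eventually_ge_at_top[of 0] show ?thesis
  proof eventually_elim
    case (elim x)
    with \<epsilon>[of x] show ?case by (simp add: field_simps)
  qed
qed

lemma z_ge_half: "\<forall>\<^sub>F x in at_top. 1 / 2 \<le> z x"
proof (rule z_lower_if[where b' = "\<lambda>_. 0"])
  have 1: "\<forall>\<^sub>F x in at_top. \<bar>\<epsilon> x\<bar> \<le> 1 / 4"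
    by (rule \<epsilon>_le) (use \<kappa> in real_asymp, simp)
  have 2: "\<forall>\<^sub>F x in at_top. 16 \<le> w x"
    using w_lim by (simp add: filterlim_at_top)
  show "\<forall>\<^sub>F x in at_top. (z x)\<^sup>2 / (3 * w x) + \<bar>\<epsilon> x\<bar> \<le> 1 - 1 / 2 + 0"
    using 1 2 z_le_2
  proof eventually_elim
    case (elim x)
    have "(z x)\<^sup>2 \<le> 2\<^sup>2" using elim(3) z_pos[of x] by (intro power_mono) auto
    then have "(z x)\<^sup>2 / (3 * w x) \<le> 2\<^sup>2 / (3 * 16)" using elim(2) by (intro frac_le) auto
    with elim(1) show ?case by simp
  qed
  show "((\<lambda>x::real. 1 / 2 * exp (- x) :: real) \<longlongrightarrow> 0) at_top" by real_asymp
qed auto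

lemma w_ge: "\<forall>\<^sub>F x in at_top. x / 4 \<le> w x"
proof -
  obtain K where K: "\<forall>\<^sub>F x in at_top. x / 2 \<le> w x + K"
  proof (rule eventually_le_if_DERIV_le[OF _ _ z_ge_half])
    show "\<forall>\<^sub>F x in at_top. ((\<lambda>x::real. x / 2) has_real_derivative 1 / 2) (at x)"
      by (intro always_eventually allI) (auto intro!: derivative_eq_intros)
    show "\<forall>\<^sub>F x in at_top. (w has_real_derivative z x) (at x)"
      by (intro always_eventually allI DERIV_w)
  qed blast
  show ?thesis
    using K eventually_ge_at_top[of "4 * K"] by eventually_elim simp
qed

lemma z_near_1: "\<forall>\<^sub>F x in at_top. \<bar>z x - 1\<bar> \<le> 7 / x"
proof -
  have e: "\<forall>\<^sub>F x in at_top. \<bar>\<epsilon> x\<bar> \<le> 1 / x"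
    by (rule \<epsilon>_le) (use \<kappa> in real_asymp, use eventually_gt_at_top[of 0] in \<open>auto elim: eventually_mono\<close>)
  have "\<forall>\<^sub>F x in at_top. 1 - 7 / x \<le> z x"
  proof (rule z_lower_if[where b' = "\<lambda>x. 7 / x\<^sup>2"])
    show "\<forall>\<^sub>F x in at_top. ((\<lambda>x. 1 - 7 / x) has_real_derivative 7 / x\<^sup>2) (at x)"
      using eventually_gt_at_top[of 0]
      by eventually_elim (auto intro!: derivative_eq_intros simp: power2_eq_square)
    show "\<forall>\<^sub>F x in at_top. (z x)\<^sup>2 / (3 * w x) + \<bar>\<epsilon> x\<bar> \<le> 1 - (1 - 7 / x) + 7 / x\<^sup>2"
      using e z_le_2 w_ge eventually_gt_at_top[of 0]
    proof eventually_elim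
      case (elim x)
      have "(z x)\<^sup>2 \<le> 2\<^sup>2" using elim(2) z_pos[of x] by (intro power_mono) auto
      then have "(z x)\<^sup>2 / (3 * w x) \<le> 2\<^sup>2 / (3 * (x / 4))" using elim by (intro frac_le) auto
      also have "\<dots> \<le> 6 / x" using elim by (simp add: field_simps)
      finally have "(z x)\<^sup>2 / (3 * w x) + \<bar>\<epsilon> x\<bar> \<le> 6 / x + 1 / x" using elim by linarith
      also have "\<dots> = 7 / x" by (simp flip: add_divide_distrib)
      also have "\<dots> \<le> 1 - (1 - 7 / x) + 7 / x\<^sup>2" by simp
      finally show ?case .
    qed
  qed real_asymp
  moreover have "\<forall>\<^sub>F x in at_top. C * exp (- \<kappa> * x) \<le> 7 / x"
  proof -
    have "\<forall>\<^sub>F x in at_top. C * (exp (- \<kappa> * x) * x) < 7"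
      by (rule order_tendstoD(2)[OF tendsto_mult_right_zero]) (use \<kappa> in real_asymp, simp)
    with eventually_gt_at_top[of 0] show ?thesis by eventually_elim (simp add: field_simps)
  qed
  ultimately show ?thesis using z_upper by eventually_elim (auto simp: abs_le_iff)
qed

lemma w_near_x: "\<forall>\<^sub>F x in at_top. \<bar>w x - x\<bar> \<le> 8 * ln x"
proof -
  have log: "\<forall>\<^sub>F x in at_top. ((\<lambda>x. 7 * ln x) has_real_derivative 7 / x) (at x)"
    using eventually_gt_at_top[of 0] by eventually_elim (auto intro!: derivative_eq_intros)
  have up: "\<forall>\<^sub>F x in at_top. ((\<lambda>x. w x - x) has_real_derivative z x - 1) (at x)"
    and down: "\<forall>\<^sub>F x in at_top. ((\<lambda>x. x - w x) has_real_derivative 1 - z x) (at x)"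
    by (intro always_eventually allI; auto intro!: derivative_eq_intros DERIV_w)+
  have bounds: "\<forall>\<^sub>F x in at_top. z x - 1 \<le> 7 / x" "\<forall>\<^sub>F x in at_top. 1 - z x \<le> 7 / x"
    using z_near_1 by (auto elim!: eventually_mono)
  obtain K1 where K1: "\<forall>\<^sub>F x in at_top. w x - x \<le> 7 * ln x + K1"
    using eventually_le_if_DERIV_le[OF up log bounds(1)] by blast
  obtain K2 where K2: "\<forall>\<^sub>F x in at_top. x - w x \<le> 7 * ln x + K2"
    using eventually_le_if_DERIV_le[OF down log bounds(2)] by blast
  have "\<forall>\<^sub>F x in at_top. K1 \<le> ln x" "\<forall>\<^sub>F x in at_top. K2 \<le> ln x" by real_asymp+
  with K1 K2 show ?thesis by eventually_elim linarith
qed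

text \<open>The difference is \<open>(z\<^sup>2 - w / x) / (3 w)\<close>, the denominator is at least a multiple of \<open>x\<close>, and both
  \<open>z\<^sup>2\<close> and \<open>w / x\<close> differ from \<open>1\<close> by \<open>O(\<close>ln \<open>x / x)\<close>.\<close>

lemma feedback_near: "\<forall>\<^sub>F x in at_top. \<bar>(z x)\<^sup>2 / (3 * w x) - 1 / (3 * x)\<bar> \<le> 50 * ln x / x\<^sup>2"
proof -
  have "\<forall>\<^sub>F x::real in at_top. 1 \<le> ln x" by real_asymp
  with z_near_1 z_le_2 w_near_x w_ge eventually_gt_at_top[of 0]
  show ?thesis
  proof eventually_elim
    case (elim x)
    have "(z x)\<^sup>2 - 1 = (z x - 1) * (z x + 1)" by (simp add: power2_eq_square algebra_simps)
    then have "\<bar>(z x)\<^sup>2 - 1\<bar> = \<bar>z x - 1\<bar> * (z x + 1)"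
      using z_pos[of x] by (simp add: abs_mult)
    also have "\<dots> \<le> 7 / x * 3" using elim z_pos[of x] by (intro mult_mono) auto
    also have "\<dots> \<le> 21 * ln x / x" using elim by (simp add: divide_right_mono)
    finally have 1: "\<bar>(z x)\<^sup>2 - 1\<bar> \<le> 21 * ln x / x" .
    have 2: "\<bar>w x / x - 1\<bar> \<le> 8 * ln x / x"
    proof -
      have "\<bar>w x / x - 1\<bar> = \<bar>w x - x\<bar> / x" using elim by (simp add: field_simps abs_divide[symmetric])
      also have "\<dots> \<le> 8 * ln x / x" using elim by (intro divide_right_mono) auto
      finally show ?thesis .
    qed
    have "(z x)\<^sup>2 / (3 * w x) - 1 / (3 * x) = ((z x)\<^sup>2 - w x / x) / (3 * w x)"
      using elim w_pos[of x] by (simp add: field_simps)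
    then have "\<bar>(z x)\<^sup>2 / (3 * w x) - 1 / (3 * x)\<bar> = \<bar>(z x)\<^sup>2 - w x / x\<bar> / (3 * w x)"
      using w_pos[of x] by simp
    also have "\<dots> \<le> (29 * ln x / x) / (3 * (x / 4))"
    proof (rule frac_le)
      have "\<bar>(z x)\<^sup>2 - w x / x\<bar> \<le> 21 * ln x / x + 8 * ln x / x" using 1 2 by linarith
      also have "\<dots> = 29 * ln x / x" by (simp flip: add_divide_distrib)
      finally show "\<bar>(z x)\<^sup>2 - w x / x\<bar> \<le> 29 * ln x / x" .
      show "0 \<le> 29 * ln x / x" using elim by (intro divide_nonneg_pos; linarith)
    qed (use elim in auto)
    also have "\<dots> = (116 / 3) * (ln x / x\<^sup>2)"
      by (simp add: power2_eq_square)
    also have "\<dots> \<le> 50 * (ln x / x\<^sup>2)"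
      using elim by (intro mult_right_mono divide_nonneg_nonneg; linarith?) auto
    also have "\<dots> = 50 * ln x / x\<^sup>2" by simp
    finally show ?case .
  qed
qed

text \<open>The function \<open>z - 1 + 1/(3 x)\<close> satisfies the unstable equation up to an error \<open>\<eta>\<close> of size
  ln \<open>x / x\<^sup>2\<close>, and \<open>\<plusminus> 52 \<close>ln \<open>x / x\<^sup>2\<close> are barriers for it because this function varies slowly.\<close>

lemma z_refined: "\<forall>\<^sub>F x in at_top. \<bar>z x - 1 + 1 / (3 * x)\<bar> \<le> 52 * ln x / x\<^sup>2"
proof -
  define \<eta> where "\<eta> x = (z x)\<^sup>2 / (3 * w x) - 1 / (3 * x) + \<epsilon> x - 1 / (3 * x\<^sup>2)" for x
  have "\<forall>\<^sub>F x in at_top. \<bar>\<epsilon> x\<bar> \<le> ln x / x\<^sup>2"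
  proof (rule \<epsilon>_le)
    show "((\<lambda>x. exp (- \<kappa> * x) / (ln x / x\<^sup>2)) \<longlongrightarrow> 0) at_top" using \<kappa> by real_asymp
    show "\<forall>\<^sub>F x::real in at_top. 0 < ln x / x\<^sup>2" by real_asymp
  qed
  moreover have "\<forall>\<^sub>F x::real in at_top. 1 \<le> ln x" by real_asymp
  ultimately have \<eta>: "\<forall>\<^sub>F x in at_top. \<bar>\<eta> x\<bar> \<le> 52 * ln x / x\<^sup>2"
    using feedback_near eventually_gt_at_top[of 0]
  proof eventually_elim
    case (elim x)
    have "\<bar>1 / (3 * x\<^sup>2)\<bar> = (1 / 3) / x\<^sup>2" by simp
    also have "\<dots> \<le> ln x / x\<^sup>2" using elim by (intro divide_right_mono) auto
    finally have "\<bar>\<eta> x\<bar> \<le> 50 * ln x / x\<^sup>2 + ln x / x\<^sup>2 + ln x / x\<^sup>2"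
      unfolding \<eta>_def using elim by linarith
    also have "\<dots> = 52 * ln x / x\<^sup>2" by (simp flip: add_divide_distrib)
    finally show ?case .
  qed
  \<comment> \<open>The sign \<open>\<sigma>\<close> treats both inequalities at once.\<close>
  have "\<forall>\<^sub>F x in at_top. \<sigma> * (z x - 1 + 1 / (3 * x)) - 52 * ln x / x\<^sup>2 \<le> 0" if "\<bar>\<sigma>\<bar> = 1" for \<sigma> :: real
  proof (rule nonpos_if_unstable_and_subexponential)
    have "((\<lambda>x. \<sigma> * (z x * exp (- x)) + (\<sigma> * (- 1 + 1 / (3 * x)) - 52 * ln x / x\<^sup>2) * exp (- x)) \<longlongrightarrow> \<sigma> * 0 + 0) at_top"
      by (intro tendsto_add tendsto_mult tendsto_const z_sub) real_asymp
    then show "((\<lambda>x. (\<sigma> * (z x - 1 + 1 / (3 * x)) - 52 * ln x / x\<^sup>2) * exp (- x)) \<longlongrightarrow> 0) at_top"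
      by (simp add: algebra_simps)
    show "\<forall>\<^sub>F x in at_top. ((\<lambda>x. \<sigma> * (z x - 1 + 1 / (3 * x)) - 52 * ln x / x\<^sup>2) has_real_derivative
        \<sigma> * (z x - 1 + 1 / (3 * x) + \<eta> x) - 52 * (1 - 2 * ln x) / x ^ 3) (at x) \<and>
        \<sigma> * (z x - 1 + 1 / (3 * x)) - 52 * ln x / x\<^sup>2 \<le>
        \<sigma> * (z x - 1 + 1 / (3 * x) + \<eta> x) - 52 * (1 - 2 * ln x) / x ^ 3"
      using \<eta> \<open>\<forall>\<^sub>F x::real in at_top. 1 \<le> ln x\<close> eventually_gt_at_top[of 0]
    proof eventually_elim
      case (elim x)
      have "((\<lambda>x. \<sigma> * (z x - 1 + 1 / (3 * x)) - 52 * ln x / x\<^sup>2) has_real_derivative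
          \<sigma> * (z x - 1 + (z x)\<^sup>2 / (3 * w x) + \<epsilon> x - 1 / (3 * x\<^sup>2)) - 52 * (1 - 2 * ln x) / x ^ 3) (at x)"
        using elim by (auto intro!: derivative_eq_intros DERIV_z simp: field_simps power2_eq_square power3_eq_cube)
      moreover have "\<bar>\<sigma> * \<eta> x\<bar> \<le> 52 * ln x / x\<^sup>2" using elim that by (simp add: abs_mult)
      moreover have "52 * (1 - 2 * ln x) / x ^ 3 \<le> 0" using elim by (simp add: divide_le_0_iff)
      ultimately show ?case by (simp add: \<eta>_def algebra_simps)
    qed
  qed
  from this[of 1, simplified] this[of "-1", simplified] show ?thesis
    by eventually_elim (simp add: abs_le_iff)
qed

lemma w_asymptotics:
  obtains c where "(\<lambda>x. w x - (x - ln x / 3 + c)) \<in> O[at_top](\<lambda>x. ln x / x)"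
proof -
  have "\<forall>\<^sub>F x in at_top. ((\<lambda>x. w x - x + ln x / 3) has_real_derivative z x - 1 + 1 / (3 * x)) (at x)"
    using eventually_gt_at_top[of 0] by eventually_elim (auto intro!: derivative_eq_intros DERIV_w)
  moreover have "\<forall>\<^sub>F x in at_top. ((\<lambda>x. 52 * (ln x + 1) / x) has_real_derivative - (52 * ln x / x\<^sup>2)) (at x)"
    using eventually_gt_at_top[of 0]
    by eventually_elim (auto intro!: derivative_eq_intros simp: field_simps power2_eq_square)
  moreover have "((\<lambda>x::real. 52 * (ln x + 1) / x) \<longlongrightarrow> 0) at_top" by real_asymp
  ultimately obtain c where c: "\<forall>\<^sub>F x in at_top. \<bar>w x - x + ln x / 3 - c\<bar> \<le> 52 * (ln x + 1) / x"
    using converges_with_rate[OF _ _ z_refined] by blast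
  have "\<forall>\<^sub>F x::real in at_top. 52 * (ln x + 1) / x \<le> 104 * (ln x / x)" by real_asymp
  with c have "\<forall>\<^sub>F x in at_top. norm (w x - (x - ln x / 3 + c)) \<le> 104 * norm (ln x / x)"
    using eventually_gt_at_top[of 1]
  proof eventually_elim
    case (elim x)
    then have "norm (ln x / x) = ln x / x" by simp
    moreover have "norm (w x - (x - ln x / 3 + c)) = \<bar>w x - x + ln x / 3 - c\<bar>"
      unfolding real_norm_def by (rule arg_cong[of _ _ abs]) simp
    ultimately show ?case using elim by linarith
  qed
  then show ?thesis by (rule that[OF bigoI])
qed

end
text \<open>Replacing \<open>f\<close> by \<open>e = sqrt(2 E)\<close> removes \<open>P\<close> from the differentiated quantities: \<open>E\<close> has two derivatives
  with simple equations, whereas \<open>f\<close> would bring in derivatives of \<open>P\<close>. The price is the error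
  \<open>\<epsilon> = 1 - e / f\<close>, which is as small as \<open>P\<close>.\<close>

lemma profile_asymptotics:
  fixes E v p :: "real \<Rightarrow> real"
  defines "f \<equiv> \<lambda>x. sqrt (2 * (E x + p x))"
  assumes U: "U > 0" and E: "\<And>x. (E has_real_derivative v x) (at x)"
    and v: "\<And>x. (v has_real_derivative v x - U / f x) (at x)"
    and v_pos: "\<And>x. 0 < v x" and v_le: "\<And>x. v x \<le> D"
    and E_ge: "\<And>x. \<theta> \<le> E x" "\<theta> > 0" and Ep: "\<And>x. \<delta> \<le> E x + p x" "\<delta> > 0"
    and p: "\<And>x. x \<ge> 0 \<Longrightarrow> \<bar>p x\<bar> \<le> C * exp (- \<kappa> * x)" and \<kappa>: "\<kappa> > 0"
  obtains c where "(\<lambda>x. f x ^ 3 / (3 * U) - (x - ln x / 3 + c)) \<in> O[at_top](\<lambda>x. ln x / x)"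
proof -
  define e where "e x = sqrt (2 * E x)" for x
  define w where "w x = e x ^ 3 / (3 * U)" for x
  define z where "z x = e x * v x / U" for x
  define \<epsilon> where "\<epsilon> x = 1 - e x / f x" for x
  have E_pos: "0 < E x" for x using E_ge(1)[of x] E_ge(2) by linarith
  have e_pos: "0 < e x" for x using E_pos[of x] by (simp add: e_def)
  have f_pos: "0 < f x" for x using Ep(1)[of x] Ep(2) by (simp add: f_def)
  have e2: "(e x)\<^sup>2 = 2 * E x" and f2: "(f x)\<^sup>2 = 2 * (E x + p x)" for x
    using E_pos[of x] Ep(1)[of x] Ep(2) by (simp_all add: e_def f_def)
  have D: "D > 0" using v_pos[of 0] v_le[of 0] by linarith
  have C0: "C \<ge> 0" using p[of 0] by simp
  have DE: "(e has_real_derivative v x / e x) (at x)" for x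
    unfolding e_def using E_pos[of x] E by (auto intro!: derivative_eq_intros simp: field_simps)
  have Dw: "(w has_real_derivative z x) (at x)" for x
    unfolding w_def z_def using e_pos[of x] U
    by (auto intro!: derivative_eq_intros DE simp: field_simps power2_eq_square)
  have Dz: "(z has_real_derivative z x - 1 + (z x)\<^sup>2 / (3 * w x) + \<epsilon> x) (at x)" for x
  proof -
    have "(z has_real_derivative (v x / e x * v x + (v x - U / f x) * e x) / U) (at x)"
      unfolding z_def using U by (auto intro!: derivative_eq_intros DE v)
    moreover have "(v x / e x * v x + (v x - U / f x) * e x) / U
        = z x - 1 + (z x)\<^sup>2 / (3 * w x) + \<epsilon> x"
      using U e_pos[of x] f_pos[of x]
      by (simp add: z_def w_def \<epsilon>_def field_simps power2_eq_square power3_eq_cube)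
    ultimately show ?thesis by simp
  qed
  \<comment> \<open>Differences of \<open>f\<close> and \<open>e\<close> are controlled by \<open>f\<^sup>2 - e\<^sup>2 = 2 p\<close>.\<close>
  have fe: "(f x - e x) * (f x + e x) = 2 * p x" for x
    using e2[of x] f2[of x] by (simp add: algebra_simps power2_eq_square)
  have e_ge: "sqrt (2 * \<theta>) \<le> e x" and f_ge: "sqrt (2 * \<delta>) \<le> f x" for x
    using E_ge(1)[of x] Ep(1)[of x] by (simp_all add: e_def f_def)
  have \<epsilon>_le: "\<bar>\<epsilon> x\<bar> \<le> C / \<delta> * exp (- \<kappa> * x)" if "x \<ge> 0" for x
  proof -
    have "\<epsilon> x = 2 * p x / (f x * (f x + e x))"
      using f_pos[of x] e_pos[of x] unfolding fe[symmetric] \<epsilon>_def by (simp add: divide_simps)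
    then have "\<bar>\<epsilon> x\<bar> = 2 * \<bar>p x\<bar> / (f x * (f x + e x))"
      using f_pos[of x] e_pos[of x] by (simp add: abs_mult)
    also have "\<dots> \<le> 2 * (C * exp (- \<kappa> * x)) / (2 * \<delta>)"
    proof (rule frac_le)
      have "2 * \<delta> \<le> (f x)\<^sup>2" using f2[of x] Ep(1)[of x] by simp
      also have "\<dots> \<le> f x * (f x + e x)"
        using f_pos[of x] e_pos[of x] by (simp add: power2_eq_square algebra_simps)
      finally show "2 * \<delta> \<le> f x * (f x + e x)" .
    qed (use p[OF that] Ep C0 in auto)
    finally show ?thesis by simp
  qed
  have E_mono: "E x \<le> E y" if "x \<le> y" for x y
    using E v_pos that by (intro DERIV_nonneg_imp_nondecreasing[of x y E]) (auto intro: less_imp_le)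
  have E_le: "E x \<le> E 0 + D * x" if "x \<ge> 0" for x
  proof -
    have "E x - D * x \<le> E 0 - D * 0"
    proof (rule DERIV_nonpos_imp_nonincreasing[OF that])
      fix t show "\<exists>d. ((\<lambda>t. E t - D * t) has_real_derivative d) (at t) \<and> d \<le> 0"
        using v_le[of t] by (intro exI[of _ "v t - D"]) (auto intro!: derivative_eq_intros E)
    qed
    then show ?thesis by simp
  qed
  have e_le: "e x \<le> 1 + 2 * E x" for x
    using e2[of x] sum_squares_bound[of 1 "e x"] E_pos[of x] by simp
  have z_sub: "((\<lambda>x. z x * exp (- x)) \<longlongrightarrow> 0) at_top"
  proof (rule tendsto_sandwich[OF _ _ tendsto_const])
    show "\<forall>\<^sub>F x in at_top. 0 \<le> z x * exp (- x)"
      using e_pos v_pos U by (intro always_eventually) (simp add: z_def less_imp_le)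
    show "\<forall>\<^sub>F x in at_top. z x * exp (- x) \<le> (1 + 2 * E 0 + 2 * D * x) * D / U * exp (- x)"
      using eventually_ge_at_top[of 0]
    proof eventually_elim
      case (elim x)
      have "e x * v x \<le> (1 + 2 * E 0 + 2 * D * x) * D"
        using e_le[of x] E_le[OF elim] e_pos[of x] v_pos[of x] v_le[of x] by (intro mult_mono) auto
      then show ?case using U by (auto simp: z_def intro!: mult_right_mono divide_right_mono)
    qed
    have "((\<lambda>x. (1 + 2 * E 0) * D / U * exp (- x) + 2 * D * D / U * (x * exp (- x)))
        \<longlongrightarrow> (1 + 2 * E 0) * D / U * 0 + 2 * D * D / U * 0) at_top"
      by (intro tendsto_add tendsto_mult tendsto_const; real_asymp)
    then show "((\<lambda>x. (1 + 2 * E 0 + 2 * D * x) * D / U * exp (- x)) \<longlongrightarrow> 0) at_top"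
      by (simp add: algebra_simps add_divide_distrib)
  qed
  \<comment> \<open>If \<open>E\<close> stayed bounded, so would \<open>f\<close>, and by instability \<open>v\<close> could not fall below \<open>U / f1\<close>, which forces linear growth of \<open>E\<close>.\<close>
  have E_lim: "filterlim E at_top at_top"
  proof (rule ccontr)
    assume "\<not> ?thesis"
    then obtain M where M: "\<not> (\<forall>\<^sub>F x in at_top. M \<le> E x)" by (auto simp: filterlim_at_top)
    have EM: "E x \<le> M" for x
    proof (rule ccontr)
      assume "\<not> E x \<le> M"
      then have "\<forall>y\<ge>x. M \<le> E y" using E_mono[of x] by force
      with M show False unfolding eventually_at_top_linorder by blast
    qed
    define f1 where "f1 = sqrt (2 * (M + C))"
    have f1: "f x \<le> f1" if "x \<ge> 0" for x
    proof -
      have "C * exp (- \<kappa> * x) \<le> C" using C0 \<kappa> that by (simp add: mult_left_le)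
      then have "p x \<le> C" using p[OF that] by linarith
      then show ?thesis using EM[of x] unfolding f_def f1_def by (intro real_sqrt_le_mono) simp
    qed
    have f1_pos: "f1 > 0" using f1[of 0] f_pos[of 0] by simp
    have "\<forall>\<^sub>F x in at_top. U / f1 - v x \<le> 0"
    proof (rule nonpos_if_unstable_and_subexponential)
      have "((\<lambda>x. v x * exp (- x)) \<longlongrightarrow> 0) at_top"
      proof (rule tendsto_sandwich[OF always_eventually always_eventually tendsto_const])
        show "\<forall>x. 0 \<le> v x * exp (- x)" using v_pos by (simp add: less_imp_le)
        show "\<forall>x. v x * exp (- x) \<le> D * exp (- x)" using v_le by simp
        show "((\<lambda>x. D * exp (- x)) \<longlongrightarrow> 0) at_top" by real_asymp
      qed
      moreover have "((\<lambda>x. U / f1 * exp (- x)) \<longlongrightarrow> 0) at_top" by real_asymp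
      ultimately have "((\<lambda>x. U / f1 * exp (- x) - v x * exp (- x)) \<longlongrightarrow> 0 - 0) at_top"
        by (rule tendsto_diff[rotated])
      then show "((\<lambda>x. (U / f1 - v x) * exp (- x)) \<longlongrightarrow> 0) at_top"
        by (simp add: left_diff_distrib)
      show "\<forall>\<^sub>F x in at_top. ((\<lambda>x. U / f1 - v x) has_real_derivative - (v x - U / f x)) (at x) \<and>
          U / f1 - v x \<le> - (v x - U / f x)"
        using eventually_ge_at_top[of 0]
      proof eventually_elim
        case (elim x)
        have "U / f1 \<le> U / f x" using f1[OF elim] f_pos[of x] U by (intro divide_left_mono) auto
        then show ?case by (auto intro!: derivative_eq_intros v)
      qed
    qed
    then have slope: "\<forall>\<^sub>F x in at_top. U / f1 \<le> v x" by simp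
    obtain K where K: "\<forall>\<^sub>F x in at_top. U / f1 * x \<le> E x + K"
    proof (rule eventually_le_if_DERIV_le[OF _ _ slope])
      show "\<forall>\<^sub>F x in at_top. ((\<lambda>x. U / f1 * x) has_real_derivative U / f1) (at x)"
        using DERIV_cmult_Id by (intro always_eventually allI)
      show "\<forall>\<^sub>F x in at_top. (E has_real_derivative v x) (at x)"
        by (intro always_eventually allI E)
    qed blast
    have "U / f1 > 0" using U f1_pos by simp
    then have "filterlim (\<lambda>x. U / f1 * x) at_top at_top" by real_asymp
    then have "\<forall>\<^sub>F x in at_top. M + K < U / f1 * x" by (simp add: filterlim_at_top_dense)
    with K have "\<forall>\<^sub>F x::real in at_top. False"
      by eventually_elim (use EM in \<open>smt (verit)\<close>)
    then show False by simp
  qed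
  have w_lim: "filterlim w at_top at_top"
  proof (rule filterlim_at_top_mono)
    show "filterlim (\<lambda>x. sqrt (2 * \<theta>) * 2 / (3 * U) * E x) at_top at_top"
      using E_ge(2) U by (intro filterlim_tendsto_pos_mult_at_top[OF tendsto_const _ E_lim]) simp
    show "\<forall>\<^sub>F x in at_top. sqrt (2 * \<theta>) * 2 / (3 * U) * E x \<le> w x"
    proof (intro always_eventually allI)
      fix x
      have "sqrt (2 * \<theta>) * (e x)\<^sup>2 \<le> e x * (e x)\<^sup>2" using e_ge[of x] by (intro mult_right_mono) auto
      then have "sqrt (2 * \<theta>) * (e x)\<^sup>2 / (3 * U) \<le> e x ^ 3 / (3 * U)"
        using U by (simp add: divide_right_mono power3_eq_cube power2_eq_square)
      then show "sqrt (2 * \<theta>) * 2 / (3 * U) * E x \<le> w x"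
        unfolding e2 w_def by simp
    qed
  qed
  interpret velocity_equation w z \<epsilon> "C / \<delta>" \<kappa>
  proof
    show "0 < w x" for x using e_pos[of x] U by (simp add: w_def)
    show "0 < z x" for x using e_pos[of x] v_pos[of x] U by (simp add: z_def)
  qed (fact Dw Dz \<epsilon>_le \<kappa> z_sub w_lim)+
  obtain c where c: "(\<lambda>x. w x - (x - ln x / 3 + c)) \<in> O[at_top](\<lambda>x. ln x / x)"
    using w_asymptotics by blast
  define K where "K = 2 * C * (2 + 4 * E 0 + 4 * D + 2 * C) / (3 * U)"
  have diff: "\<bar>f x ^ 3 / (3 * U) - w x\<bar> \<le> K * ((1 + x) * exp (- \<kappa> * x))" if x: "x \<ge> 0" for x
  proof -
    have pC: "\<bar>p x\<bar> \<le> C * exp (- \<kappa> * x)" by (rule p[OF x])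
    also have "\<dots> \<le> C" using C0 \<kappa> x by (simp add: mult_left_le)
    finally have pC': "\<bar>p x\<bar> \<le> C" .
    have "f x \<le> 1 + 2 * (E x + p x)"
      using f_pos[of x] sum_squares_bound[of 1 "f x"] unfolding f2[symmetric] by simp
    moreover have "p x \<le> C" using abs_ge_self pC' by (rule order_trans)
    ultimately have "f x \<le> 1 + 2 * E x + 2 * C" by simp
    then have "f x + e x \<le> 2 + 4 * E x + 2 * C" using e_le[of x] by simp
    also have "\<dots> \<le> 2 + 4 * (E 0 + D * x) + 2 * C" using E_le[OF x] by simp
    also have "\<dots> \<le> (2 + 4 * E 0 + 4 * D + 2 * C) * (1 + x)"
      using x D C0 E_pos[of 0] by (simp add: algebra_simps)
    finally have s: "f x + e x \<le> (2 + 4 * E 0 + 4 * D + 2 * C) * (1 + x)" .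
    have "\<bar>f x ^ 3 - e x ^ 3\<bar> = \<bar>f x - e x\<bar> * ((f x)\<^sup>2 + f x * e x + (e x)\<^sup>2)"
    proof -
      have "f x ^ 3 - e x ^ 3 = (f x - e x) * ((f x)\<^sup>2 + f x * e x + (e x)\<^sup>2)"
        by (simp add: algebra_simps power2_eq_square power3_eq_cube)
      then show ?thesis using f_pos[of x] e_pos[of x] by (simp add: abs_mult)
    qed
    also have "\<dots> \<le> \<bar>f x - e x\<bar> * (f x + e x)\<^sup>2"
      using f_pos[of x] e_pos[of x] by (intro mult_left_mono) (auto simp: power2_eq_square algebra_simps)
    also have "\<dots> = \<bar>2 * p x\<bar> * (f x + e x)"
      using f_pos[of x] e_pos[of x] unfolding fe[symmetric] by (simp add: abs_mult power2_eq_square)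
    also have "\<dots> \<le> (2 * (C * exp (- \<kappa> * x))) * ((2 + 4 * E 0 + 4 * D + 2 * C) * (1 + x))"
      using pC s f_pos[of x] e_pos[of x] C0 by (intro mult_mono) auto
    finally have "\<bar>f x ^ 3 - e x ^ 3\<bar> / (3 * U) \<le>
        (2 * (C * exp (- \<kappa> * x))) * ((2 + 4 * E 0 + 4 * D + 2 * C) * (1 + x)) / (3 * U)"
      using U by (intro divide_right_mono) auto
    also have "\<dots> = K * ((1 + x) * exp (- \<kappa> * x))" by (simp add: K_def)
    also have "\<bar>f x ^ 3 - e x ^ 3\<bar> / (3 * U) = \<bar>f x ^ 3 / (3 * U) - w x\<bar>"
      using U by (simp add: w_def abs_divide flip: diff_divide_distrib)
    finally show ?thesis .
  qed
  have "(\<lambda>x. f x ^ 3 / (3 * U) - w x) \<in> O[at_top](\<lambda>x. (1 + x) * exp (- \<kappa> * x))"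
  proof (rule bigoI)
    show "\<forall>\<^sub>F x in at_top. norm (f x ^ 3 / (3 * U) - w x) \<le> K * norm ((1 + x) * exp (- \<kappa> * x))"
      using eventually_ge_at_top[of 0] by eventually_elim (use diff in \<open>simp add: abs_mult\<close>)
  qed
  also have "(\<lambda>x. (1 + x) * exp (- \<kappa> * x)) \<in> O[at_top](\<lambda>x. ln x / x)"
    using \<kappa> by real_asymp
  finally have "(\<lambda>x. (f x ^ 3 / (3 * U) - w x) + (w x - (x - ln x / 3 + c))) \<in> O[at_top](\<lambda>x. ln x / x)"
    by (rule sum_in_bigo(1)) (rule c)
  also have "(\<lambda>x. (f x ^ 3 / (3 * U) - w x) + (w x - (x - ln x / 3 + c)))
      = (\<lambda>x. f x ^ 3 / (3 * U) - (x - ln x / 3 + c))" by auto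
  finally show ?thesis by (rule that)
qed

section \<open>Uniqueness\<close>

lemma increasing_inverse:
  fixes G g :: "real \<Rightarrow> real"
  defines "Y \<equiv> inv_into {0..} G"
  assumes cont: "continuous_on {0..} G" and G0: "G 0 = 0"
    and "\<forall>y>0. (G has_real_derivative g y) (at y)" and "\<forall>y>0. 0 < g y"
    and lim: "filterlim G at_top at_top"
  shows "\<And>h. 0 \<le> h \<Longrightarrow> G (Y h) = h" "\<And>y. 0 \<le> y \<Longrightarrow> Y (G y) = y" "Y 0 = 0"
    "\<And>h. 0 < h \<Longrightarrow> 0 < Y h" "\<And>y. 0 < y \<Longrightarrow> 0 < G y"
    "\<And>h. 0 < h \<Longrightarrow> (Y has_real_derivative 1 / g (Y h)) (at h)"
    "filterlim Y (at_right 0) (at_right 0)" "filterlim Y at_top at_top" "continuous_on {0..} Y"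
proof -
  have DG: "(G has_real_derivative g y) (at y)" and g: "0 < g y" if "0 < y" for y
    using assms(4,5) that by auto
  have mono: "G x < G y" if "0 \<le> x" "x < y" for x y
  proof (rule DERIV_pos_imp_increasing_open[OF that(2)])
    show "\<exists>d. (G has_real_derivative d) (at t) \<and> 0 < d" if "x < t" for t
      using DG[of t] g[of t] that \<open>0 \<le> x\<close> by auto
    show "continuous_on {x..y} G" by (rule continuous_on_subset[OF cont]) (use that in auto)
  qed
  have inj: "inj_on G {0..}"
    using mono by (intro linorder_inj_onI) (auto simp: less_imp_neq)
  have img: "h \<in> G ` {0..}" if "0 \<le> h" for h
  proof -
    obtain b where b: "0 \<le> b" "h \<le> G b"
      using filterlim_at_top[THEN iffD1, OF lim, rule_format, of h]
      unfolding eventually_at_top_linorder by (metis linorder_linear)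
    have "\<exists>x\<ge>0. x \<le> b \<and> G x = h"
    proof (rule IVT')
      show "continuous_on {0..b} G" by (rule continuous_on_subset[OF cont]) auto
    qed (use b that G0 in auto)
    then show ?thesis by auto
  qed
  show GY: "G (Y h) = h" if "0 \<le> h" for h
    unfolding Y_def by (rule f_inv_into_f[OF img[OF that]])
  show YG: "Y (G y) = y" if "0 \<le> y" for y
    unfolding Y_def using inv_into_f_f[OF inj] that by auto
  show Y0: "Y 0 = 0" using YG[of 0] G0 by simp
  have Y_ge: "0 \<le> Y h" if "0 \<le> h" for h
    using inv_into_into[OF img[OF that]] by (simp add: Y_def)
  show Y_pos: "0 < Y h" if "0 < h" for h
    using Y_ge[of h] GY[of h] G0 that by (cases "Y h = 0") auto
  show "0 < G y" if "0 < y" for y using mono[of 0 y] G0 that by simp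
  have isCont_Y: "isCont Y h" if "0 < h" for h
  proof -
    have "isCont Y (G (Y h))"
      by (rule isCont_inverse_function2[of "Y h / 2" _ "2 * Y h"])
         (use Y_pos[OF that] in \<open>auto intro!: YG DERIV_isCont[OF DG]\<close>)
    then show ?thesis using GY that by simp
  qed
  show "(Y has_real_derivative 1 / g (Y h)) (at h)" if "0 < h" for h
    using DERIV_inverse_function[of G "g (Y h)" Y h 0 "h + 1"] DG[OF Y_pos[OF that]]
      g[OF Y_pos[OF that]] GY isCont_Y[OF that] that by (simp add: divide_inverse)
  have Y_less: "Y h < y" if "0 \<le> h" "h < G y" "0 \<le> y" for h y
    using mono[of y "Y h"] GY[of h] that by (cases "Y h = y") force+
  have small: "\<forall>\<^sub>F h in at_right 0. Y h < e" if "0 < e" for e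
    using mono[of 0 e] that G0 Y_less
    by (intro eventually_at_rightI[of 0 "G e"]) auto
  show Y_right: "filterlim Y (at_right 0) (at_right 0)"
    unfolding filterlim_at
  proof (intro conjI order_tendstoI)
    show pos: "\<forall>\<^sub>F h in at_right 0. Y h \<in> {0<..} \<and> Y h \<noteq> 0"
      by (intro eventually_at_rightI[of 0 1]) (use Y_pos in force)+
    show "\<forall>\<^sub>F h in at_right 0. a < Y h" if "a < 0" for a
      using pos by eventually_elim (use that in auto)
  qed (use small in auto)
  show "filterlim Y at_top at_top"
    unfolding filterlim_at_top_ge[of _ _ 0]
  proof (intro allI impI)
    fix Z :: real assume Z: "0 \<le> Z"
    show "\<forall>\<^sub>F h in at_top. Z \<le> Y h"
      using eventually_ge_at_top[of "G Z"]
    proof eventually_elim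
      case (elim h)
      have "0 \<le> G Z" using mono[of 0 Z] Z G0 by (cases "Z = 0") auto
      then show ?case using mono[of "Y h" Z] Y_ge[of h] GY[of h] elim by force
    qed
  qed
  show "continuous_on {0..} Y"
  proof -
    have "(Y \<longlongrightarrow> Y 0) (at 0 within {0..})"
      using Y_right unfolding filterlim_at Y0 at_within_Ici_at_right by simp
    then show ?thesis
      unfolding continuous_on_eq_continuous_within continuous_within
      using isCont_Y by (metis atLeast_iff continuous_at_imp_continuous_within continuous_within less_eq_real_def)
  qed
qed

text \<open>If \<open>w\<close> were positive somewhere, \<open>w - \<eta> h - \<eta>\<close> would, for small \<open>\<eta>\<close>, attain a positive maximum:
  it is negative near \<open>0\<close> and at large \<open>h\<close>. At the maximum \<open>w\<close> is positive, and strict convexity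
  contradicts maximality.\<close>

lemma maximum_principle:
  fixes w w1 w2 :: "real \<Rightarrow> real"
  assumes D1: "\<And>h. 0 < h \<Longrightarrow> (w has_real_derivative w1 h) (at h)"
    and D2: "\<And>h. 0 < h \<Longrightarrow> (w1 has_real_derivative w2 h) (at h)"
    and convex: "\<And>h. 0 < h \<Longrightarrow> 0 < w h \<Longrightarrow> 0 < w2 h"
    and zero: "(w \<longlongrightarrow> 0) (at_right 0)" and sublinear: "((\<lambda>h. w h / h) \<longlongrightarrow> 0) at_top"
    and h0: "0 < h0"
  shows "w h0 \<le> 0"
proof (rule ccontr)
  assume n: "\<not> w h0 \<le> 0"
  define \<eta> where "\<eta> = w h0 / (2 * (h0 + 1))"
  have \<eta>: "0 < \<eta>" using n h0 by (simp add: \<eta>_def)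
  define \<phi> where "\<phi> h = w h - \<eta> * h - \<eta>" for h
  have \<phi>0: "0 < \<phi> h0"
  proof -
    have "\<phi> h0 = w h0 - \<eta> * (h0 + 1)" by (simp add: \<phi>_def algebra_simps)
    also have "\<eta> * (h0 + 1) = w h0 / 2" using h0 by (simp add: \<eta>_def field_simps)
    finally show ?thesis using n by simp
  qed
  have "\<forall>\<^sub>F h in at_right 0. w h < \<eta>" using zero \<eta> by (rule order_tendstoD)
  then obtain a' where a': "0 < a'" "\<And>h. 0 < h \<Longrightarrow> h < a' \<Longrightarrow> w h < \<eta>"
    by (auto simp: eventually_at_right_field)
  \<comment> \<open>The maximum is sought on \<open>[a, b]\<close>, at whose end points \<open>\<phi>\<close> is negative.\<close>
  define a where "a = min a' h0 / 2"
  have a: "0 < a" "a < h0" and "a < a'"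
    using a'(1) h0 by (auto simp: a_def min_def)
  have "\<phi> a < 0"
    using a'(2)[OF a(1) \<open>a < a'\<close>] mult_pos_pos[OF \<eta> a(1)] by (simp add: \<phi>_def)
  have "\<forall>\<^sub>F h in at_top. w h / h < \<eta>" using sublinear \<eta> by (rule order_tendstoD)
  then obtain b' where b': "\<And>h. b' \<le> h \<Longrightarrow> w h / h < \<eta>" by (auto simp: eventually_at_top_linorder)
  define b where "b = max b' (h0 + 1)"
  have b: "h0 < b" by (simp add: b_def)
  have "\<phi> b < 0"
    using b'[of b] h0 b \<eta> by (simp add: \<phi>_def b_def pos_divide_less_eq)
  have D\<phi>: "(\<phi> has_real_derivative w1 h - \<eta>) (at h)" if "0 < h" for h
    unfolding \<phi>_def using that by (auto intro!: derivative_eq_intros D1)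
  have "continuous_on {a..b} \<phi>"
    using a by (intro continuous_at_imp_continuous_on ballI DERIV_isCont[OF D\<phi>]) auto
  then obtain h1 where h1: "h1 \<in> {a..b}" "\<And>h. h \<in> {a..b} \<Longrightarrow> \<phi> h \<le> \<phi> h1"
    using continuous_attains_sup[of "{a..b}" \<phi>] a b by fastforce
  have pos: "0 < \<phi> h1" using h1(2)[of h0] \<phi>0 a b by simp
  then have h1': "a < h1" "h1 < b" using \<open>\<phi> a < 0\<close> \<open>\<phi> b < 0\<close> h1(1) by (force simp: less_le)+
  have "0 < h1" using a h1' by simp
  have "w1 h1 - \<eta> = 0"
    using h1' h1(2)
    by (intro DERIV_local_max[OF D\<phi>[OF \<open>0 < h1\<close>], of "min (h1 - a) (b - h1)"]) (auto simp: abs_if split: if_splits)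
  moreover have "0 < w h1" using pos \<eta> mult_pos_pos[OF \<eta> \<open>0 < h1\<close>] by (simp add: \<phi>_def)
  then have "0 < w2 h1" by (rule convex[OF \<open>0 < h1\<close>])
  then obtain d where d: "0 < d" "\<And>s. 0 < s \<Longrightarrow> s < d \<Longrightarrow> w1 h1 < w1 (h1 + s)"
    using DERIV_pos_inc_right[OF D2[OF \<open>0 < h1\<close>]] by blast
  \<comment> \<open>Strict convexity makes \<open>\<phi>\<close> increase to the right of its maximum.\<close>
  define c where "c = min d (b - h1) / 2"
  have c: "0 < c" "c < d" "h1 + c < b" using d h1' by (auto simp: c_def min_def field_simps)
  have "\<phi> h1 < \<phi> (h1 + c)"
  proof (rule DERIV_pos_imp_increasing_open[of h1 "h1 + c" \<phi>])
    fix x assume x: "h1 < x" "x < h1 + c"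
    have "w1 h1 < w1 x" using d(2)[of "x - h1"] x c by simp
    then show "\<exists>y. (\<phi> has_real_derivative y) (at x) \<and> 0 < y"
      using D\<phi>[of x] x \<open>0 < h1\<close> \<open>w1 h1 - \<eta> = 0\<close> by (intro exI[of _ "w1 x - \<eta>"]) auto
  next
    show "continuous_on {h1..h1 + c} \<phi>"
      using \<open>0 < h1\<close> by (intro continuous_at_imp_continuous_on ballI DERIV_isCont[OF D\<phi>]) auto
  qed (use c in auto)
  moreover have "\<phi> (h1 + c) \<le> \<phi> h1" using h1(2)[of "h1 + c"] c a h1' by simp
  ultimately show False by simp
qed

lemma C_diff_onD:
  assumes "C_diff_on k f {0<..}" "j < k" "0 < x"
  shows "((deriv ^^ j) f has_real_derivative (deriv ^^ Suc j) f x) (at x)"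
  using assms unfolding C_diff_on_def by (auto simp: DERIV_deriv_iff_field_differentiable)

text \<open>The change of variables for an arbitrary solution: \<open>Y\<close> is the inverse of \<open>G\<close>, \<open>f\<close> its slope as a
  function of the height, \<open>E\<close> the energy and \<open>V\<close> the derivative of \<open>E\<close>. The condition at infinity
  makes \<open>G\<close> unbounded and \<open>E\<close> sublinear: the slope exceeds \<open>2\<close> eventually, so \<open>G(y) \<ge> y\<close>, and the slope squared divided by
  \<open>G\<close> is then at most a multiple of ln \<open>y / y\<close>.\<close>

lemma solution_energy:
  assumes U: "0 < U" and P: "C_diff_on 2 P {0<..}" "(P \<longlongrightarrow> 0) at_top"
    and sol: "is_solution U \<Theta> P G" and G': "\<And>y. 0 < y \<Longrightarrow> 0 < deriv G y"
  obtains Y f E V where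
    "\<And>h. 0 \<le> h \<Longrightarrow> G (Y h) = h" "\<And>y. 0 \<le> y \<Longrightarrow> Y (G y) = y" "\<And>h. 0 < h \<Longrightarrow> 0 < f h"
    "\<And>h. 0 < h \<Longrightarrow> (Y has_real_derivative 1 / f h) (at h)" "(Y \<longlongrightarrow> 0) (at_right 0)"
    "\<And>h. (f h)\<^sup>2 = 2 * (E h + P h)"
    "\<And>h. 0 < h \<Longrightarrow> (E has_real_derivative V h) (at h)"
    "\<And>h. 0 < h \<Longrightarrow> (V has_real_derivative - U / (h\<^sup>2 * f h)) (at h)"
    "(E \<longlongrightarrow> \<Theta>) (at_right 0)" "((\<lambda>h. E h / h) \<longlongrightarrow> 0) at_top" "\<And>y. 0 < y \<Longrightarrow> 0 < G y"
proof -
  have S: "C_diff_on 3 G {0<..}" "continuous_on {0..} G" "G 0 = 0"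
    "\<And>y. 0 < y \<Longrightarrow> (G y)\<^sup>2 * deriv (\<lambda>t. deriv (deriv G) t - deriv P (G t)) y = - U"
    "\<And>y. 0 < y \<Longrightarrow> 0 < G y"
    "((\<lambda>y. deriv G y ^ 3 / ln y) \<longlongrightarrow> 3 * U) at_top"
    "((\<lambda>y. (deriv G y)\<^sup>2 / 2 - P (G y)) \<longlongrightarrow> \<Theta>) (at_right 0)"
    using sol unfolding is_solution_def by auto
  have D1: "(G has_real_derivative deriv G y) (at y)"
    and D2: "(deriv G has_real_derivative deriv (deriv G) y) (at y)"
    and D3: "(deriv (deriv G) has_real_derivative deriv (deriv (deriv G)) y) (at y)" if "0 < y" for y
    using C_diff_onD[OF S(1), of 0 y] C_diff_onD[OF S(1), of 1 y] C_diff_onD[OF S(1), of 2 y] that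
    by (simp_all add: numeral_2_eq_2)
  have P1: "(P has_real_derivative deriv P h) (at h)"
    and P2: "(deriv P has_real_derivative deriv (deriv P) h) (at h)" if "0 < h" for h
    using C_diff_onD[OF P(1), of 0 h] C_diff_onD[OF P(1), of 1 h] that by simp_all
  have large: "\<forall>\<^sub>F y in at_top. 2 \<le> deriv G y \<and> deriv G y ^ 3 \<le> (3 * U + 1) * ln y"
  proof -
    have "\<forall>\<^sub>F y in at_top. 2 * U < deriv G y ^ 3 / ln y" "\<forall>\<^sub>F y in at_top. deriv G y ^ 3 / ln y < 3 * U + 1"
      using order_tendstoD[OF S(6)] U by auto
    moreover have "\<forall>\<^sub>F y in at_top. 8 \<le> 2 * U * ln y" using U by real_asymp
    ultimately show ?thesis using eventually_gt_at_top[of 1]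
    proof eventually_elim
      case (elim y)
      have "2 * U * ln y < deriv G y ^ 3" using elim by (simp add: pos_less_divide_eq)
      then have "2 ^ 3 \<le> deriv G y ^ 3" using elim by simp
      then have "2 \<le> deriv G y" using G'[of y] elim by (subst (asm) power_mono_iff) auto
      then show ?case using elim by (simp add: pos_divide_less_eq)
    qed
  qed
  have G_ge: "\<forall>\<^sub>F y in at_top. y \<le> G y"
  proof -
    obtain K where K: "\<forall>\<^sub>F y in at_top. 2 * y \<le> G y + K"
    proof (rule eventually_le_if_DERIV_le)
      show "\<forall>\<^sub>F y in at_top. ((\<lambda>y::real. 2 * y) has_real_derivative 2) (at y)"
        by (intro always_eventually allI) (auto intro!: derivative_eq_intros)
      show "\<forall>\<^sub>F y in at_top. (G has_real_derivative deriv G y) (at y)"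
        using eventually_gt_at_top[of 0] by eventually_elim (rule D1)
      show "\<forall>\<^sub>F y in at_top. 2 \<le> deriv G y" using large by (auto elim: eventually_mono)
    qed blast
    show ?thesis using K eventually_ge_at_top[of K] by eventually_elim simp
  qed
  then have G_lim: "filterlim G at_top at_top" by (rule filterlim_at_top_mono[OF filterlim_ident])
  define Y where "Y = inv_into {0..} G"
  have "\<forall>y>0. (G has_real_derivative deriv G y) (at y)" "\<forall>y>0. 0 < deriv G y"
    using D1 G' by auto
  note inv = increasing_inverse[OF S(2,3) this G_lim, folded Y_def]
  define f where "f h = deriv G (Y h)" for h
  define E where "E h = (f h)\<^sup>2 / 2 - P h" for h
  define V where "V h = deriv (deriv G) (Y h) - deriv P h" for h
  have f_pos: "0 < f h" if "0 < h" for h using G' inv(4)[OF that] by (simp add: f_def)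
  have DY: "(Y has_real_derivative 1 / f h) (at h)" if "0 < h" for h
    using inv(6)[OF that] by (simp add: f_def)
  have Df: "(f has_real_derivative deriv (deriv G) (Y h) * (1 / f h)) (at h)" if "0 < h" for h
    unfolding f_def[abs_def]
    using DERIV_chain2[OF D2[OF inv(4)[OF that]] DY[OF that]] by (simp add: f_def)
  have DE: "(E has_real_derivative V h) (at h)" if "0 < h" for h
    unfolding E_def[abs_def] V_def using f_pos[OF that] that
    by (auto intro!: derivative_eq_intros Df P1)
  have DV: "(V has_real_derivative - U / (h\<^sup>2 * f h)) (at h)" if "0 < h" for h
  proof -
    let ?q = "\<lambda>t. deriv (deriv G) t - deriv P (G t)"
    have y: "0 < Y h" "G (Y h) = h" using inv(1,4) that by auto
    have "(?q has_real_derivative deriv ?q (Y h)) (at (Y h))"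
      unfolding DERIV_deriv_iff_real_differentiable real_differentiable_def
      by (rule exI, rule DERIV_diff[OF D3[OF y(1)] DERIV_chain2[OF P2 D1[OF y(1)]]])
        (use y that in simp)
    from DERIV_chain2[OF this DY[OF that]]
    have "((\<lambda>h. ?q (Y h)) has_real_derivative deriv ?q (Y h) * (1 / f h)) (at h)" .
    moreover have "deriv ?q (Y h) = (h\<^sup>2 * deriv ?q (Y h)) / h\<^sup>2" using that by simp
    then have "deriv ?q (Y h) = - U / h\<^sup>2" unfolding S(4)[OF y(1), unfolded y(2)] .
    then have "deriv ?q (Y h) * (1 / f h) = - U / (h\<^sup>2 * f h)" by simp
    ultimately have "((\<lambda>h. ?q (Y h)) has_real_derivative - U / (h\<^sup>2 * f h)) (at h)" by simp
    then show ?thesis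
      by (rule has_field_derivative_transform_within_open[of _ _ _ "{0<..}"])
         (use that inv(1) in \<open>auto simp: V_def\<close>)
  qed
  have E_right: "(E \<longlongrightarrow> \<Theta>) (at_right 0)"
  proof (rule Lim_transform_eventually)
    show "((\<lambda>h. (deriv G (Y h))\<^sup>2 / 2 - P (G (Y h))) \<longlongrightarrow> \<Theta>) (at_right 0)"
      by (rule filterlim_compose[OF S(7) inv(7)])
    show "\<forall>\<^sub>F h in at_right 0. (deriv G (Y h))\<^sup>2 / 2 - P (G (Y h)) = E h"
      using eventually_at_right_less[of 0] by eventually_elim (simp add: E_def f_def inv(1))
  qed
  have E_top: "((\<lambda>h. E h / h) \<longlongrightarrow> 0) at_top"
  proof -
    have "((\<lambda>y. (deriv G y)\<^sup>2 / G y) \<longlongrightarrow> 0) at_top"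
    proof (rule tendsto_sandwich[OF _ _ tendsto_const])
      show "\<forall>\<^sub>F y in at_top. 0 \<le> (deriv G y)\<^sup>2 / G y"
        using eventually_gt_at_top[of 0] by eventually_elim (simp add: S(5) less_imp_le)
      show "\<forall>\<^sub>F y in at_top. (deriv G y)\<^sup>2 / G y \<le> (3 * U + 1) * (ln y / y)"
        using large G_ge eventually_gt_at_top[of 0]
      proof eventually_elim
        case (elim y)
        have "(deriv G y)\<^sup>2 \<le> deriv G y ^ 3" using elim by (intro power_increasing) auto
        then have "(deriv G y)\<^sup>2 \<le> (3 * U + 1) * ln y" using elim by linarith
        moreover have "0 \<le> (3 * U + 1) * ln y"
          using calculation zero_le_power2[of "deriv G y"] by linarith
        ultimately have "(deriv G y)\<^sup>2 / G y \<le> ((3 * U + 1) * ln y) / y"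
          using elim by (intro frac_le) auto
        then show ?case by simp
      qed
      show "((\<lambda>y. (3 * U + 1) * (ln y / y)) \<longlongrightarrow> 0) at_top"
        by (rule tendsto_mult_right_zero) real_asymp
    qed
    then have "((\<lambda>h. (deriv G (Y h))\<^sup>2 / G (Y h)) \<longlongrightarrow> 0) at_top"
      by (rule filterlim_compose[OF _ inv(8)])
    moreover have "((\<lambda>h. P h * (1 / h)) \<longlongrightarrow> 0 * 0) at_top"
      by (intro tendsto_mult P(2)) real_asymp
    ultimately have "((\<lambda>h. (deriv G (Y h))\<^sup>2 / G (Y h) / 2 - P h * (1 / h)) \<longlongrightarrow> 0 / 2 - 0 * 0) at_top"
      by (intro tendsto_diff tendsto_divide) auto
    then have lim: "((\<lambda>h. (deriv G (Y h))\<^sup>2 / G (Y h) / 2 - P h * (1 / h)) \<longlongrightarrow> 0) at_top" by simp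
    show ?thesis
    proof (rule Lim_transform_eventually[OF lim])
      show "\<forall>\<^sub>F h in at_top. (deriv G (Y h))\<^sup>2 / G (Y h) / 2 - P h * (1 / h) = E h / h"
        using eventually_gt_at_top[of 0]
        by eventually_elim (simp add: E_def f_def inv(1) field_simps)
    qed
  qed
  have Y_right: "(Y \<longlongrightarrow> 0) (at_right 0)" using inv(7) by (simp add: filterlim_at)
  have sq: "(f h)\<^sup>2 = 2 * (E h + P h)" for h by (simp add: E_def)
  show ?thesis
    by (rule that[OF inv(1,2) f_pos DY Y_right sq DE DV E_right E_top S(5)])
qed

text \<open>Where one energy exceeds the other, so does the slope, and the source \<open>U / (h\<^sup>2 f)\<close> is smaller; the
  maximum principle, used in both directions, identifies the energies. Equal slopes give equal
  inverse functions, as these agree at \<open>0\<close>.\<close>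

lemma solution_unique:
  assumes U: "0 < U" and P: "C_diff_on 2 P {0<..}" "(P \<longlongrightarrow> 0) at_top"
    and "is_solution U \<Theta> P G" "\<And>y. 0 < y \<Longrightarrow> 0 < deriv G y"
    and "is_solution U \<Theta> P H" "\<And>y. 0 < y \<Longrightarrow> 0 < deriv H y"
    and y: "0 \<le> y"
  shows "G y = H y"
proof -
  obtain Y1 f1 E1 V1 where 1:
    "\<And>h. 0 \<le> h \<Longrightarrow> G (Y1 h) = h" "\<And>y. 0 \<le> y \<Longrightarrow> Y1 (G y) = y" "\<And>h. 0 < h \<Longrightarrow> 0 < f1 h"
    "\<And>h. 0 < h \<Longrightarrow> (Y1 has_real_derivative 1 / f1 h) (at h)" "(Y1 \<longlongrightarrow> 0) (at_right 0)"
    "\<And>h. (f1 h)\<^sup>2 = 2 * (E1 h + P h)"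
    "\<And>h. 0 < h \<Longrightarrow> (E1 has_real_derivative V1 h) (at h)"
    "\<And>h. 0 < h \<Longrightarrow> (V1 has_real_derivative - U / (h\<^sup>2 * f1 h)) (at h)"
    "(E1 \<longlongrightarrow> \<Theta>) (at_right 0)" "((\<lambda>h. E1 h / h) \<longlongrightarrow> 0) at_top" "\<And>y. 0 < y \<Longrightarrow> 0 < G y"
    using solution_energy[OF U P assms(4,5)] by blast
  obtain Y2 f2 E2 V2 where 2:
    "\<And>h. 0 \<le> h \<Longrightarrow> H (Y2 h) = h" "\<And>y. 0 \<le> y \<Longrightarrow> Y2 (H y) = y" "\<And>h. 0 < h \<Longrightarrow> 0 < f2 h"
    "\<And>h. 0 < h \<Longrightarrow> (Y2 has_real_derivative 1 / f2 h) (at h)" "(Y2 \<longlongrightarrow> 0) (at_right 0)"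
    "\<And>h. (f2 h)\<^sup>2 = 2 * (E2 h + P h)"
    "\<And>h. 0 < h \<Longrightarrow> (E2 has_real_derivative V2 h) (at h)"
    "\<And>h. 0 < h \<Longrightarrow> (V2 has_real_derivative - U / (h\<^sup>2 * f2 h)) (at h)"
    "(E2 \<longlongrightarrow> \<Theta>) (at_right 0)" "((\<lambda>h. E2 h / h) \<longlongrightarrow> 0) at_top" "\<And>y. 0 < y \<Longrightarrow> 0 < H y"
    using solution_energy[OF U P assms(6,7)] by blast
  have compare: "E h \<le> E' h"
    if "0 < h" and f_pos: "\<And>h. 0 < h \<Longrightarrow> 0 < f h" "\<And>h. 0 < h \<Longrightarrow> 0 < f' h"
    and sq: "\<And>h. (f h)\<^sup>2 = 2 * (E h + P h)" "\<And>h. (f' h)\<^sup>2 = 2 * (E' h + P h)"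
    and D: "\<And>h. 0 < h \<Longrightarrow> (E has_real_derivative V h) (at h)"
    "\<And>h. 0 < h \<Longrightarrow> (E' has_real_derivative V' h) (at h)"
    "\<And>h. 0 < h \<Longrightarrow> (V has_real_derivative - U / (h\<^sup>2 * f h)) (at h)"
    "\<And>h. 0 < h \<Longrightarrow> (V' has_real_derivative - U / (h\<^sup>2 * f' h)) (at h)"
    and lim: "(E \<longlongrightarrow> \<Theta>) (at_right 0)" "(E' \<longlongrightarrow> \<Theta>) (at_right 0)"
    "((\<lambda>h. E h / h) \<longlongrightarrow> 0) at_top" "((\<lambda>h. E' h / h) \<longlongrightarrow> 0) at_top"
    for E E' V V' f f' :: "real \<Rightarrow> real" and h
  proof -
    have "E h - E' h \<le> 0"
    proof (rule maximum_principle[of "\<lambda>h. E h - E' h" "\<lambda>h. V h - V' h"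
          "\<lambda>h. - U / (h\<^sup>2 * f h) - - U / (h\<^sup>2 * f' h)"])
      show "((\<lambda>h. E h - E' h) has_real_derivative V h - V' h) (at h)"
        "((\<lambda>h. V h - V' h) has_real_derivative - U / (h\<^sup>2 * f h) - - U / (h\<^sup>2 * f' h)) (at h)"
        if "0 < h" for h by (intro DERIV_diff D that)+
      show "0 < - U / (h\<^sup>2 * f h) - - U / (h\<^sup>2 * f' h)" if h: "0 < h" "0 < E h - E' h" for h
      proof -
        have "(f' h)\<^sup>2 < (f h)\<^sup>2" using h by (simp add: sq)
        then have "f' h < f h" using f_pos(1)[OF h(1)] by (simp add: power2_less_imp_less)
        then have "h\<^sup>2 * f' h < h\<^sup>2 * f h" using h by simp
        then have "U / (h\<^sup>2 * f h) < U / (h\<^sup>2 * f' h)"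
          using f_pos(2)[OF h(1)] h U by (intro divide_strict_left_mono) auto
        then show ?thesis by simp
      qed
      show "((\<lambda>h. E h - E' h) \<longlongrightarrow> 0) (at_right 0)" using tendsto_diff[OF lim(1,2)] by simp
      show "((\<lambda>h. (E h - E' h) / h) \<longlongrightarrow> 0) at_top"
        using tendsto_diff[OF lim(3,4)] by (simp add: diff_divide_distrib)
    qed fact
    then show ?thesis by simp
  qed
  have f_eq: "f1 h = f2 h" if "0 < h" for h
  proof -
    have "E1 h \<le> E2 h" by (rule compare[OF that 1(3) 2(3) 1(6) 2(6) 1(7) 2(7) 1(8) 2(8) 1(9) 2(9) 1(10) 2(10)])
    moreover have "E2 h \<le> E1 h" by (rule compare[OF that 2(3) 1(3) 2(6) 1(6) 2(7) 1(7) 2(8) 1(8) 2(9) 1(9) 2(10) 1(10)])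
    ultimately have "(f1 h)\<^sup>2 = (f2 h)\<^sup>2" using 1(6) 2(6) by simp
    then show ?thesis using 1(3)[OF that] 2(3)[OF that] by (simp add: power2_eq_iff_nonneg)
  qed
  have Y_eq: "Y1 h = Y2 h" if "0 < h" for h
  proof -
    have "\<exists>c. \<forall>h\<in>{0<..}. Y1 h - Y2 h = c"
    proof (rule has_field_derivative_zero_constant)
      fix h :: real assume "h \<in> {0<..}"
      then have "((\<lambda>h. Y1 h - Y2 h) has_real_derivative 1 / f1 h - 1 / f2 h) (at h)"
        by (intro DERIV_diff 1(4) 2(4)) auto
      then show "((\<lambda>h. Y1 h - Y2 h) has_real_derivative 0) (at h within {0<..})"
        using f_eq \<open>h \<in> _\<close> by (auto intro: has_field_derivative_at_within)
    qed simp
    then obtain c where c: "\<And>h. 0 < h \<Longrightarrow> Y1 h - Y2 h = c" by auto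
    have "((\<lambda>h. Y1 h - Y2 h) \<longlongrightarrow> 0 - 0) (at_right 0)" by (intro tendsto_diff 1(5) 2(5))
    moreover have "((\<lambda>h. Y1 h - Y2 h) \<longlongrightarrow> c) (at_right 0)"
      by (rule tendsto_eventually) (use eventually_at_right_less[of 0] c in \<open>auto elim: eventually_mono\<close>)
    ultimately have "c = 0" using tendsto_unique[OF trivial_limit_at_right_real] by fastforce
    then show ?thesis using c[OF that] by simp
  qed
  show ?thesis
  proof (cases "y = 0")
    case True
    then show ?thesis using assms(4,6) by (simp add: is_solution_def)
  next
    case False
    then have "0 < H y" using y 2(11) by simp
    then have "H y = G (Y2 (H y))" using 1(1)[of "H y"] Y_eq by simp
    then show ?thesis using 2(2)[OF y] by simp
  qed
qed

section \<open>The energy profile of the film\<close>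

locale film_potential =
  fixes U \<Theta> m A :: real and P :: "real \<Rightarrow> real"
  assumes U: "U > 0" and \<Theta>: "\<Theta> > 0"
    and P_C2: "C_diff_on 2 P {0<..}"
    and m: "m > 1" and A: "A > 0"
    and P_zero: "P \<sim>[at_right 0] (\<lambda>h. A / (m - 1) * h powr (1 - m))"
    and P_top: "(P \<longlongrightarrow> 0) at_top" and P'_top: "(deriv P \<longlongrightarrow> 0) at_top"
    and P''_top: "\<exists>p>1. (\<lambda>h. h powr (p + 1) * deriv (deriv P) h) \<in> O[at_top](\<lambda>_. 1)"
    and P_inf: "(INF h\<in>{0<..}. P h) + \<Theta> > 0"
begin

lemma DERIV_P: "0 < h \<Longrightarrow> (P has_real_derivative deriv P h) (at h)"
  and DERIV_P': "0 < h \<Longrightarrow> (deriv P has_real_derivative deriv (deriv P) h) (at h)"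
  using C_diff_onD[OF P_C2, of 0 h] C_diff_onD[OF P_C2, of 1 h] by simp_all

lemma P_cont: "continuous_on {0<..} P"
  by (intro continuous_at_imp_continuous_on ballI DERIV_isCont[OF DERIV_P]) auto

lemma P_ratio: "((\<lambda>h. P h / h powr (1 - m)) \<longlongrightarrow> A / (m - 1)) (at_right 0)"
proof -
  have "((\<lambda>h. P h / (A / (m - 1) * h powr (1 - m))) \<longlongrightarrow> 1) (at_right 0)"
  proof (rule Lim_transform_eventually[OF asymp_equivD[OF P_zero]])
    show "\<forall>\<^sub>F h in at_right 0. (if P h = 0 \<and> A / (m - 1) * h powr (1 - m) = 0 then 1
        else P h / (A / (m - 1) * h powr (1 - m))) = P h / (A / (m - 1) * h powr (1 - m))"
      using eventually_at_right_less[of 0] by eventually_elim (use A m in auto)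
  qed
  then have "((\<lambda>h. A / (m - 1) * (P h / (A / (m - 1) * h powr (1 - m)))) \<longlongrightarrow> A / (m - 1) * 1) (at_right 0)"
    by (intro tendsto_mult tendsto_const)
  then show ?thesis
    using A m by simp
qed

lemma P_near_0:
  obtains h0 where "0 < h0" "\<And>h. 0 < h \<Longrightarrow> h < h0 \<Longrightarrow> A / (m - 1) / 2 * h powr (1 - m) \<le> P h"
proof -
  have "0 < A / (m - 1)" using A m by simp
  moreover have "x / 2 < x" if "0 < x" for x :: real using that by simp
  ultimately have "A / (m - 1) / 2 < A / (m - 1)" by blast
  then have "\<forall>\<^sub>F h in at_right 0. A / (m - 1) / 2 < P h / h powr (1 - m)"
    by (rule order_tendstoD[OF P_ratio])
  then obtain h0 where "0 < h0" "\<And>h. 0 < h \<Longrightarrow> h < h0 \<Longrightarrow> A / (m - 1) / 2 < P h / h powr (1 - m)"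
    by (auto simp: eventually_at_right_field)
  then show ?thesis
    by (intro that[of h0]) (auto simp: less_divide_eq intro: less_imp_le)
qed

lemma P_bounded_away:
  assumes "0 < h0" obtains M where "\<And>h. h0 \<le> h \<Longrightarrow> \<bar>P h\<bar> \<le> M"
proof -
  have "\<forall>\<^sub>F h in at_top. \<bar>P h\<bar> < 1" using tendstoD[OF P_top, of 1] by (simp add: dist_real_def)
  then obtain b where b: "\<And>h. b \<le> h \<Longrightarrow> \<bar>P h\<bar> < 1" by (auto simp: eventually_at_top_linorder)
  have "bounded (P ` {h0..b})"
    by (intro compact_imp_bounded compact_continuous_image continuous_on_subset[OF P_cont])
      (use assms in auto)
  then obtain M where M: "\<And>h. h \<in> {h0..b} \<Longrightarrow> \<bar>P h\<bar> \<le> M"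
    unfolding bounded_iff by (metis imageI real_norm_def)
  have "\<bar>P h\<bar> \<le> max M 1" if "h0 \<le> h" for h
    using b[of h] M[of h] that by (cases "h \<le> b") auto
  then show ?thesis by (rule that)
qed

text \<open>The infimum of a real set carries information only if the set is bounded below. Here \<open>P\<close> is positive near
  \<open>0\<close>, where it blows up, and bounded elsewhere; the hypothesis on the infimum thus becomes a pointwise bound.\<close>

lemma P_bdd_below: "bdd_below (P ` {0<..})"
proof -
  obtain h0 where h0: "0 < h0" "\<And>h. 0 < h \<Longrightarrow> h < h0 \<Longrightarrow> A / (m - 1) / 2 * h powr (1 - m) \<le> P h"
    using P_near_0 by blast
  obtain M where M: "\<And>h. h0 \<le> h \<Longrightarrow> \<bar>P h\<bar> \<le> M" using P_bounded_away[OF h0(1)] by blast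
  have "- \<bar>M\<bar> \<le> P h" if "0 < h" for h
  proof (cases "h < h0")
    case True
    have "0 \<le> A / (m - 1) / 2 * h powr (1 - m)" using A m by simp
    then show ?thesis using h0(2)[OF that True] by linarith
  next
    case False
    then show ?thesis using M[of h] by linarith
  qed
  then show ?thesis by (intro bdd_belowI2[of _ "- \<bar>M\<bar>"]) auto
qed

lemma total_ge:
  obtains \<delta> where "0 < \<delta>" "\<And>h. 0 < h \<Longrightarrow> \<delta> \<le> \<Theta> + P h"
proof (rule that[of "(INF h\<in>{0<..}. P h) + \<Theta>"])
  show "(INF h\<in>{0<..}. P h) + \<Theta> \<le> \<Theta> + P h" if "0 < h" for h
    using cINF_lower[OF P_bdd_below, of h] that by simp
qed (rule P_inf)

text \<open>Integrating the bound on \<open>P''\<close> twice from infinity, where \<open>P'\<close> and \<open>P\<close> vanish, gives a bound by \<open>h\<close> to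
  the power \<open>1 - p\<close>, an exponential in \<open>x\<close>. Compactness extends it to all \<open>h \<ge> 1\<close>.\<close>

lemma P_decay:
  obtains C \<kappa> where "0 < \<kappa>" "\<And>x. 0 \<le> x \<Longrightarrow> \<bar>P (exp x)\<bar> \<le> C * exp (- \<kappa> * x)"
proof -
  obtain p where p: "p > 1" "(\<lambda>h. h powr (p + 1) * deriv (deriv P) h) \<in> O[at_top](\<lambda>_. 1)"
    using P''_top by blast
  obtain K where K: "0 < K" "\<forall>\<^sub>F h in at_top. \<bar>h powr (p + 1) * deriv (deriv P) h\<bar> \<le> K"
    using landau_o.bigE[OF p(2)] by (auto simp: abs_mult)
  have 1: "\<forall>\<^sub>F h in at_top. \<bar>deriv (deriv P) h\<bar> \<le> K * h powr (- p - 1)"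
    using K(2) eventually_gt_at_top[of 0]
  proof eventually_elim
    case (elim h)
    have "\<bar>deriv (deriv P) h\<bar> = \<bar>h powr (p + 1) * deriv (deriv P) h\<bar> * h powr (- p - 1)"
      using elim(2) by (simp add: abs_mult flip: powr_add)
    also have "\<dots> \<le> K * h powr (- p - 1)" using elim by (intro mult_right_mono) auto
    finally show ?case .
  qed
  have D1: "\<forall>\<^sub>F h in at_top. ((\<lambda>h. K / p * h powr - p) has_real_derivative - (K * h powr (- p - 1))) (at h)"
    using eventually_gt_at_top[of 0] by eventually_elim (use p in \<open>auto intro!: derivative_eq_intros\<close>)
  have L1: "((\<lambda>h. K / p * h powr - p) \<longlongrightarrow> 0) at_top"
    by (rule tendsto_mult_right_zero) (use p in real_asymp)
  have "\<forall>\<^sub>F h in at_top. (deriv P has_real_derivative deriv (deriv P) h) (at h)"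
    using eventually_gt_at_top[of 0] by eventually_elim (rule DERIV_P')
  from converges_with_rate[OF this D1 1 L1] obtain c where
    c: "\<forall>\<^sub>F h in at_top. \<bar>deriv P h - c\<bar> \<le> K / p * h powr - p" "(deriv P \<longlongrightarrow> c) at_top" by blast
  have "c = 0" using tendsto_unique[OF _ c(2) P'_top] by simp
  then have 2: "\<forall>\<^sub>F h in at_top. \<bar>deriv P h\<bar> \<le> K / p * h powr - p" using c(1) by simp
  define L where "L = K / p / (p - 1)"
  have D2: "\<forall>\<^sub>F h in at_top. ((\<lambda>h. L * h powr (1 - p)) has_real_derivative - (K / p * h powr - p)) (at h)"
    using eventually_gt_at_top[of 0]
  proof eventually_elim
    case (elim h)
    have "L * (p - 1) = K / p" using p by (simp add: L_def)
    then have L: "L * (1 - p) = - (K / p)" by (simp add: algebra_simps)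
    have "((\<lambda>h. L * h powr (1 - p)) has_real_derivative L * ((1 - p) * h powr (1 - p - 1))) (at h)"
      using elim by (auto intro!: derivative_eq_intros)
    also have "L * ((1 - p) * h powr (1 - p - 1)) = - (K / p * h powr - p)"
      unfolding mult.assoc[symmetric] L by simp
    finally show ?case .
  qed
  have L2: "((\<lambda>h. L * h powr (1 - p)) \<longlongrightarrow> 0) at_top"
    by (rule tendsto_mult_right_zero) (use p in real_asymp)
  have "\<forall>\<^sub>F h in at_top. (P has_real_derivative deriv P h) (at h)"
    using eventually_gt_at_top[of 0] by eventually_elim (rule DERIV_P)
  from converges_with_rate[OF this D2 2 L2] obtain c where
    c: "\<forall>\<^sub>F h in at_top. \<bar>P h - c\<bar> \<le> L * h powr (1 - p)" "(P \<longlongrightarrow> c) at_top" by blast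
  have "c = 0" using tendsto_unique[OF _ c(2) P_top] by simp
  then have "\<forall>\<^sub>F h in at_top. \<bar>P h\<bar> \<le> L * h powr (1 - p)" using c(1) by simp
  then obtain b where b: "\<And>h. b \<le> h \<Longrightarrow> \<bar>P h\<bar> \<le> L * h powr (1 - p)"
    by (auto simp: eventually_at_top_linorder)
  obtain M where M: "\<And>h. 1 \<le> h \<Longrightarrow> \<bar>P h\<bar> \<le> M" using P_bounded_away[of 1] by auto
  \<comment> \<open>Where \<open>exp x < b\<close>, the factor \<open>b powr (p - 1) * exp x powr (1 - p)\<close> exceeds \<open>1\<close>.\<close>
  have "\<bar>P (exp x)\<bar> \<le> max L (M * \<bar>b\<bar> powr (p - 1)) * exp (- (p - 1) * x)" if "0 \<le> x" for x
  proof -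
    have e: "exp x powr (1 - p) = exp (- (p - 1) * x)" by (simp add: powr_def algebra_simps)
    show ?thesis
    proof (cases "b \<le> exp x")
      case True
      then have "\<bar>P (exp x)\<bar> \<le> L * exp (- (p - 1) * x)" using b[OF True] by (simp only: e)
      also have "\<dots> \<le> max L (M * \<bar>b\<bar> powr (p - 1)) * exp (- (p - 1) * x)" by (intro mult_right_mono) auto
      finally show ?thesis .
    next
      case False
      have "exp x powr (p - 1) \<le> \<bar>b\<bar> powr (p - 1)" using False p by (intro powr_mono2) auto
      then have "exp x powr (p - 1) * exp x powr (1 - p) \<le> \<bar>b\<bar> powr (p - 1) * exp x powr (1 - p)"
        by (intro mult_right_mono) auto
      then have "1 \<le> \<bar>b\<bar> powr (p - 1) * exp x powr (1 - p)" by (simp flip: powr_add)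
      moreover have "0 \<le> M" using M[of 1] by linarith
      ultimately have "M * 1 \<le> M * (\<bar>b\<bar> powr (p - 1) * exp x powr (1 - p))" by (intro mult_left_mono)
      moreover have "\<bar>P (exp x)\<bar> \<le> M" using M[of "exp x"] that by simp
      ultimately have "\<bar>P (exp x)\<bar> \<le> M * \<bar>b\<bar> powr (p - 1) * exp (- (p - 1) * x)"
        unfolding e by (simp only: mult.assoc mult_1_right)
      also have "\<dots> \<le> max L (M * \<bar>b\<bar> powr (p - 1)) * exp (- (p - 1) * x)" by (intro mult_right_mono) auto
      finally show ?thesis .
    qed
  qed
  then show ?thesis using p by (intro that[of "p - 1"]) auto
qed

text \<open>The exponent \<open>k\<close> must satisfy \<open>2 k \<le> m - 1\<close> for the lower bound on \<open>\<Theta> + P\<close> near \<open>h = 0\<close>, and \<open>k < 1\<close> for the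
  convergence of the integrals.\<close>

lemma profile:
  obtains E v D where
    "\<And>x. (E has_real_derivative v x) (at x)"
    "\<And>x. (v has_real_derivative v x - U / sqrt (2 * (E x + P (exp x)))) (at x)"
    "\<And>x. 0 < v x" "\<And>x. v x \<le> D" "\<And>x. \<Theta> \<le> E x" "(E \<longlongrightarrow> \<Theta>) at_bot"
proof -
  obtain \<delta> where \<delta>: "0 < \<delta>" "\<And>h. 0 < h \<Longrightarrow> \<delta> \<le> \<Theta> + P h" using total_ge by blast
  obtain h0' where h0': "0 < h0'" "\<And>h. 0 < h \<Longrightarrow> h < h0' \<Longrightarrow> A / (m - 1) / 2 * h powr (1 - m) \<le> P h"
    using P_near_0 by blast
  define h0 where "h0 = min 1 h0'"
  have h0: "0 < h0" "h0 \<le> 1" using h0' by (auto simp: h0_def)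
  obtain M where M: "\<And>h. 1 \<le> h \<Longrightarrow> \<bar>P h\<bar> \<le> M" using P_bounded_away[of 1] by auto
  define k where "k = min (1 / 2) ((m - 1) / 2)"
  have k: "0 < k" "k < 1" "2 * k \<le> m - 1" using m by (simp_all add: k_def min_def)
  define c where "c = min (A / (m - 1) / 2) (\<delta> * h0 powr (2 * k))"
  have c: "0 < c" using A m \<delta> h0 by (simp add: c_def)
  have lower: "c * h powr (- 2 * k) \<le> \<Theta> + P h" if h: "0 < h" for h
  proof (cases "h < h0")
    case True
    have "h powr (- 2 * k) \<le> h powr (1 - m)"
      using True h h0 k by (intro powr_mono') auto
    then have "c * h powr (- 2 * k) \<le> A / (m - 1) / 2 * h powr (1 - m)"
      using c A m by (intro mult_mono) (auto simp: c_def)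
    also have "\<dots> \<le> P h" using h0'(2)[OF h] True by (simp add: h0_def)
    finally show ?thesis using \<Theta> by simp
  next
    case False
    have "h powr (- 2 * k) \<le> h0 powr (- 2 * k)" using False h0 k by (intro powr_mono2') auto
    then have "c * h powr (- 2 * k) \<le> \<delta> * h0 powr (2 * k) * h0 powr (- 2 * k)"
      using c \<delta> by (intro mult_mono) (auto simp: c_def)
    also have "\<dots> = \<delta>" using h0 by (simp add: mult.assoc flip: powr_add)
    finally show ?thesis using \<delta>(2)[OF h] by simp
  qed
  interpret green_fixed_point "\<lambda>x. \<Theta> + P (exp x)" U \<delta> "\<Theta> + M" c k
  proof
    show "continuous_on UNIV (\<lambda>x. \<Theta> + P (exp x))"
      by (intro continuous_intros continuous_on_compose2[OF P_cont]) auto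
    show "c * exp (- 2 * k * x) \<le> \<Theta> + P (exp x)" for x
      using lower[of "exp x"] by (simp add: powr_def mult.commute mult.left_commute)
    show "\<Theta> + P (exp x) \<le> \<Theta> + M" if "0 \<le> x" for x
      using M[of "exp x"] that by (simp add: abs_le_iff)
  qed (use U \<delta> k c in auto)
  obtain E v D where E: "\<And>x. (E has_real_derivative v x) (at x)"
    "\<And>x. (v has_real_derivative v x - U / sqrt (2 * (\<Theta> + P (exp x) + E x))) (at x)"
    "\<And>x. 0 < v x" "\<And>x. v x \<le> D" "\<And>x. 0 \<le> E x" "(E \<longlongrightarrow> 0) at_bot"
    using profile_exists by blast
  show ?thesis
  proof (rule that[of "\<lambda>x. \<Theta> + E x" v D])
    show "((\<lambda>x. \<Theta> + E x) has_real_derivative v x) (at x)" for x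
      by (auto intro!: derivative_eq_intros E)
    show "(v has_real_derivative v x - U / sqrt (2 * (\<Theta> + E x + P (exp x)))) (at x)" for x
      using E(2)[of x] by (simp add: add.commute add.left_commute)
    show "((\<lambda>x. \<Theta> + E x) \<longlongrightarrow> \<Theta>) at_bot"
      using tendsto_add[OF tendsto_const E(6), of \<Theta>] by simp
  qed (use E in auto)
qed

text \<open>The profile as a function of \<open>h = exp(x)\<close>. With \<open>E(\<close>ln \<open>h)\<close> in place of \<open>E\<close>, its derivative is
  \<open>v / h\<close>, and the first-order term of the equation in \<open>x\<close> cancels.\<close>

lemma speed:
  obtains E V f c where
    "\<And>h. 0 < h \<Longrightarrow> (E has_real_derivative V h) (at h)"
    "\<And>h. 0 < h \<Longrightarrow> (V has_real_derivative - U / (h\<^sup>2 * f h)) (at h)"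
    "\<And>h. 0 < h \<Longrightarrow> 0 < f h" "\<And>h. 0 < h \<Longrightarrow> (f h)\<^sup>2 = 2 * (E h + P h)"
    "(E \<longlongrightarrow> \<Theta>) (at_right 0)"
    "(\<lambda>h. f h ^ 3 / (3 * U) - (ln h - ln (ln h) / 3 + c)) \<in> O[at_top](\<lambda>h. ln (ln h) / ln h)"
proof -
  obtain E v D where E: "\<And>x. (E has_real_derivative v x) (at x)"
    "\<And>x. (v has_real_derivative v x - U / sqrt (2 * (E x + P (exp x)))) (at x)"
    "\<And>x. 0 < v x" "\<And>x. v x \<le> D" "\<And>x. \<Theta> \<le> E x" "(E \<longlongrightarrow> \<Theta>) at_bot"
    using profile by blast
  obtain \<delta> where \<delta>: "0 < \<delta>" "\<And>h. 0 < h \<Longrightarrow> \<delta> \<le> \<Theta> + P h" using total_ge by blast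
  have pos: "\<delta> \<le> E x + P (exp x)" for x using \<delta>(2)[of "exp x"] E(5)[of x] by simp
  obtain C \<kappa> where P: "0 < \<kappa>" "\<And>x. 0 \<le> x \<Longrightarrow> \<bar>P (exp x)\<bar> \<le> C * exp (- \<kappa> * x)"
    using P_decay by blast
  obtain c where c: "(\<lambda>x. sqrt (2 * (E x + P (exp x))) ^ 3 / (3 * U) - (x - ln x / 3 + c)) \<in> O[at_top](\<lambda>x. ln x / x)"
    using profile_asymptotics[OF U E(1,2,3,4,5) \<Theta> pos \<delta>(1) P(2,1)] by blast
  define f where "f h = sqrt (2 * (E (ln h) + P (exp (ln h))))" for h
  show ?thesis
  proof (rule that[of "\<lambda>h. E (ln h)" "\<lambda>h. v (ln h) / h" f c])
    fix h :: real assume h: "0 < h"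
    show "((\<lambda>h. E (ln h)) has_real_derivative v (ln h) / h) (at h)"
      using DERIV_chain2[OF E(1) DERIV_ln[OF h]] by (simp add: divide_inverse)
    have "((\<lambda>h. v (ln h)) has_real_derivative (v (ln h) - U / f h) * inverse h) (at h)"
      unfolding f_def by (rule DERIV_chain2[OF E(2) DERIV_ln[OF h]])
    then show "((\<lambda>h. v (ln h) / h) has_real_derivative - U / (h\<^sup>2 * f h)) (at h)"
      using h by (auto intro!: derivative_eq_intros simp: field_simps power2_eq_square)
    show "0 < f h" using pos[of "ln h"] \<delta>(1) by (simp add: f_def)
    show "(f h)\<^sup>2 = 2 * (E (ln h) + P h)" using pos[of "ln h"] \<delta>(1) h by (simp add: f_def)
  next
    show "((\<lambda>h. E (ln h)) \<longlongrightarrow> \<Theta>) (at_right 0)"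
      by (rule filterlim_compose[OF E(6) ln_at_0])
    show "(\<lambda>h. f h ^ 3 / (3 * U) - (ln h - ln (ln h) / 3 + c)) \<in> O[at_top](\<lambda>h. ln (ln h) / ln h)"
      unfolding f_def by (rule landau_o.big.compose[OF c ln_at_top])
  qed
qed

end

section \<open>The film as the inverse of the travel time\<close>

locale film_speed = film_potential +
  fixes E V f :: "real \<Rightarrow> real" and c :: real
  assumes DERIV_E: "\<And>h. 0 < h \<Longrightarrow> (E has_real_derivative V h) (at h)"
    and DERIV_V: "\<And>h. 0 < h \<Longrightarrow> (V has_real_derivative - U / (h\<^sup>2 * f h)) (at h)"
    and f_pos: "\<And>h. 0 < h \<Longrightarrow> 0 < f h" and f_sq: "\<And>h. 0 < h \<Longrightarrow> (f h)\<^sup>2 = 2 * (E h + P h)"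
    and E_right: "(E \<longlongrightarrow> \<Theta>) (at_right 0)"
    and f_far: "(\<lambda>h. f h ^ 3 / (3 * U) - (ln h - ln (ln h) / 3 + c)) \<in> O[at_top](\<lambda>h. ln (ln h) / ln h)"
begin

lemma DERIV_f:
  assumes "0 < h" shows "(f has_real_derivative (V h + deriv P h) / f h) (at h)"
proof -
  have "E h + P h > 0" using f_sq[OF assms] f_pos[OF assms] by (smt (verit) zero_less_power)
  have s: "sqrt (2 * (E t + P t)) = f t" if "0 < t" for t
    using f_sq[OF that] f_pos[OF that] by (simp add: real_sqrt_unique)
  have "((\<lambda>h. 2 * (E h + P h)) has_real_derivative 2 * (V h + deriv P h)) (at h)"
    by (intro DERIV_cmult DERIV_add DERIV_E DERIV_P assms)
  then have "((\<lambda>h. sqrt (2 * (E h + P h))) has_real_derivative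
      inverse (sqrt (2 * (E h + P h))) / 2 * (2 * (V h + deriv P h))) (at h)"
    by (rule DERIV_chain2[OF DERIV_real_sqrt, rotated]) (use \<open>E h + P h > 0\<close> in simp)
  then have "((\<lambda>h. sqrt (2 * (E h + P h))) has_real_derivative (V h + deriv P h) / f h) (at h)"
    unfolding s[OF assms] by (rule DERIV_cong) (use f_pos[OF assms] in \<open>simp add: field_simps\<close>)
  then show ?thesis
    by (rule has_field_derivative_transform_within_open[of _ _ _ "{0<..}"]) (use assms s in auto)
qed

lemma f_cube_over_ln: "((\<lambda>h. f h ^ 3 / ln h) \<longlongrightarrow> 3 * U) at_top"
proof -
  \<comment> \<open>The error term of the expansion, which tends to \<open>0\<close>.\<close>
  define d where "d h = f h ^ 3 / (3 * U) - (ln h - ln (ln h) / 3 + c)" for h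
  obtain K where "\<forall>\<^sub>F h in at_top. norm (d h) \<le> K * norm (ln (ln h) / ln h)"
    using landau_o.bigE[OF f_far] unfolding d_def by blast
  then have d: "(d \<longlongrightarrow> 0) at_top"
    by (intro tendsto_0_le[of "\<lambda>h. ln (ln h) / ln h" _ d K]) (real_asymp, simp add: mult.commute)
  have "((\<lambda>h. 3 * U * (d h * (1 / ln h) + (ln h - ln (ln h) / 3 + c) / ln h)) \<longlongrightarrow> 3 * U * (0 * 0 + 1)) at_top"
    by (intro tendsto_mult tendsto_add tendsto_const d; real_asymp)
  moreover have "3 * U * (d h * (1 / ln h) + (ln h - ln (ln h) / 3 + c) / ln h) = f h ^ 3 / ln h" for h
  proof -
    have "d h * (1 / ln h) + (ln h - ln (ln h) / 3 + c) / ln h = f h ^ 3 / (3 * U) / ln h"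
      unfolding d_def by (simp add: diff_divide_distrib add_divide_distrib)
    then show ?thesis using U by simp
  qed
  ultimately show ?thesis by simp
qed

text \<open>Crude two-sided bounds, sufficient to compare ln \<open>y\<close> with ln \<open>H(y)\<close>.\<close>

lemma f_far_bounds: "\<forall>\<^sub>F h in at_top. 2 \<le> f h \<and> f h \<le> ln h"
proof -
  have "\<forall>\<^sub>F h in at_top. 2 * U < f h ^ 3 / ln h" "\<forall>\<^sub>F h in at_top. f h ^ 3 / ln h < 4 * U"
    using order_tendstoD[OF f_cube_over_ln] U by auto
  moreover have "\<forall>\<^sub>F h in at_top. 8 \<le> 2 * U * ln h" using U by real_asymp
  moreover have "\<forall>\<^sub>F h in at_top. 4 * U * ln h \<le> ln h ^ 3" using U by real_asymp
  ultimately show ?thesis using eventually_gt_at_top[of 1]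
  proof eventually_elim
    case (elim h)
    have "2 ^ 3 \<le> f h ^ 3" "f h ^ 3 \<le> ln h ^ 3"
      using elim by (simp_all add: pos_less_divide_eq pos_divide_less_eq)
    then show ?case
      using f_pos[of h] elim power_mono_iff[of 2 "f h" 3] power_mono_iff[of "f h" "ln h" 3] by simp
  qed
qed

text \<open>The potential dominates: \<open>E\<close> is bounded while \<open>P\<close> grows as \<open>h\<close> to the power \<open>1 - m\<close>.\<close>

lemma f_near_0: "((\<lambda>h. f h / h powr ((1 - m) / 2)) \<longlongrightarrow> sqrt (2 * A / (m - 1))) (at_right 0)"
proof -
  have "((\<lambda>h. h powr (m - 1)) \<longlongrightarrow> 0) (at_right 0)" using m by real_asymp
  then have "((\<lambda>h. 2 * (E h * h powr (m - 1) + P h / h powr (1 - m))) \<longlongrightarrow> 2 * (\<Theta> * 0 + A / (m - 1))) (at_right 0)"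
    by (intro tendsto_mult tendsto_add tendsto_const E_right P_ratio)
  then have "((\<lambda>h. sqrt (2 * (E h * h powr (m - 1) + P h / h powr (1 - m)))) \<longlongrightarrow> sqrt (2 * A / (m - 1))) (at_right 0)"
    using tendsto_real_sqrt by fastforce
  then show ?thesis
  proof (rule Lim_transform_eventually)
    show "\<forall>\<^sub>F h in at_right 0. sqrt (2 * (E h * h powr (m - 1) + P h / h powr (1 - m))) = f h / h powr ((1 - m) / 2)"
      using eventually_at_right_less[of 0]
    proof eventually_elim
      case (elim h)
      have "(f h / h powr ((1 - m) / 2))\<^sup>2 = (f h)\<^sup>2 / h powr (1 - m)"
        by (simp add: power_divide power2_eq_square flip: powr_add)
      also have "\<dots> = 2 * (E h * h powr (m - 1) + P h / h powr (1 - m))"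
        using elim powr_minus_divide[of h "m - 1"] by (simp add: f_sq algebra_simps)
      finally have "(f h / h powr ((1 - m) / 2))\<^sup>2 = 2 * (E h * h powr (m - 1) + P h / h powr (1 - m))" .
      then show ?case using f_pos[OF elim] by (intro real_sqrt_unique) auto
    qed
  qed
qed

lemma inverse_f_right: "((\<lambda>h. 1 / f h) \<longlongrightarrow> 0) (at_right 0)"
proof -
  have "sqrt (2 * A / (m - 1)) \<noteq> 0" using A m by simp
  moreover have "((\<lambda>h. h powr ((m - 1) / 2)) \<longlongrightarrow> 0) (at_right 0)" using m by real_asymp
  ultimately have "((\<lambda>h. h powr ((m - 1) / 2) / (f h / h powr ((1 - m) / 2))) \<longlongrightarrow> 0 / sqrt (2 * A / (m - 1))) (at_right 0)"
    by (intro tendsto_divide f_near_0)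
  then have "((\<lambda>h. h powr ((m - 1) / 2) / (f h / h powr ((1 - m) / 2))) \<longlongrightarrow> 0) (at_right 0)"
    by (simp only: div_0)
  then show ?thesis
  proof (rule Lim_transform_eventually)
    show "\<forall>\<^sub>F h in at_right 0. h powr ((m - 1) / 2) / (f h / h powr ((1 - m) / 2)) = 1 / f h"
      using eventually_at_right_less[of 0]
    proof eventually_elim
      case (elim h)
      have "h powr ((m - 1) / 2) * h powr ((1 - m) / 2) = 1"
        using elim by (simp add: field_simps flip: powr_add)
      then show ?case by simp
    qed
  qed
qed

text \<open>The slope is infinite at the contact line, so its reciprocal extends continuously by \<open>0\<close>.\<close>

definition slowness :: "real \<Rightarrow> real" where
  "slowness h = (if h \<le> 0 then 0 else 1 / f h)"

lemma slowness_cont: "continuous_on {0..b} slowness"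
  unfolding continuous_on_eq_continuous_within
proof
  fix h assume h: "h \<in> {0..b}"
  show "continuous (at h within {0..b}) slowness"
  proof (cases "h = 0")
    case True
    have "(slowness \<longlongrightarrow> 0) (at_right 0)"
      by (rule Lim_transform_eventually[OF inverse_f_right])
        (use eventually_at_right_less[of 0] in \<open>auto elim!: eventually_mono simp: slowness_def\<close>)
    then show ?thesis
      using True unfolding continuous_within
      by (auto simp: slowness_def at_within_Ici_at_right[symmetric] intro: tendsto_within_subset)
  next
    case False
    then have "0 < h" using h by simp
    have "isCont (\<lambda>h. 1 / f h) h"
      using DERIV_isCont[OF DERIV_f[OF \<open>0 < h\<close>]] f_pos[OF \<open>0 < h\<close>] by (intro continuous_intros) auto
    moreover have "\<forall>\<^sub>F t in nhds h. 1 / f t = slowness t"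
      using eventually_nhds_in_open[of "{0<..}" h] \<open>0 < h\<close>
      by (auto elim!: eventually_mono simp: slowness_def)
    ultimately have "isCont slowness h" by (simp add: isCont_cong)
    then show ?thesis by (rule continuous_at_imp_continuous_at_within)
  qed
qed

text \<open>The position \<open>y\<close> at which the film has height \<open>h\<close>.\<close>

definition travel_time :: "real \<Rightarrow> real" where
  "travel_time h = integral {0..h} slowness"

lemma DERIV_travel_time_within:
  assumes "0 \<le> h" "h \<le> b" shows "(travel_time has_real_derivative slowness h) (at h within {0..b})"
  unfolding travel_time_def[abs_def]
  by (rule integral_has_real_derivative[OF slowness_cont]) (use assms in auto)

lemma DERIV_travel_time: "0 < h \<Longrightarrow> (travel_time has_real_derivative 1 / f h) (at h)"
  using DERIV_travel_time_within[of h "h + 1"] at_within_Icc_at[of 0 h "h + 1"]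
  by (simp add: slowness_def)

lemma travel_time_0: "travel_time 0 = 0" by (simp add: travel_time_def)

lemma travel_time_cont: "continuous_on {0..} travel_time"
  unfolding continuous_on_eq_continuous_within
proof
  fix h :: real assume h: "h \<in> {0..}"
  show "continuous (at h within {0..}) travel_time"
  proof (cases "h = 0")
    case True
    have "continuous (at 0 within {0..1}) travel_time"
      using DERIV_continuous[OF DERIV_travel_time_within[of 0 1]] by simp
    then show ?thesis
      unfolding True by (simp add: at_within_Icc_at_right at_within_Ici_at_right)
  next
    case False
    then show ?thesis
      using h DERIV_isCont[OF DERIV_travel_time[of h]]
      by (auto intro: continuous_at_imp_continuous_at_within)
  qed
qed

text \<open>The derivative of \<open>h / \<close>ln \<open>h\<close> is at most \<open>1 / \<close>ln \<open>h\<close>, which is at most \<open>1 / f\<close>; in the other direction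
  \<open>f \<ge> 2\<close>.\<close>

lemma travel_time_bounds: "\<forall>\<^sub>F h in at_top. h / (2 * ln h) \<le> travel_time h \<and> travel_time h \<le> h"
proof -
  have D: "\<forall>\<^sub>F h in at_top. (travel_time has_real_derivative 1 / f h) (at h)"
    using eventually_gt_at_top[of 0] by eventually_elim (rule DERIV_travel_time)
  obtain K where K: "\<forall>\<^sub>F h in at_top. h / ln h \<le> travel_time h + K"
  proof (rule eventually_le_if_DERIV_le[OF _ D])
    show "\<forall>\<^sub>F h in at_top. ((\<lambda>h. h / ln h) has_real_derivative 1 / ln h - 1 / (ln h)\<^sup>2) (at h)"
      using eventually_gt_at_top[of 1]
      by eventually_elim (auto intro!: derivative_eq_intros simp: field_simps power2_eq_square)
    show "\<forall>\<^sub>F h in at_top. 1 / ln h - 1 / (ln h)\<^sup>2 \<le> 1 / f h"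
      using f_far_bounds eventually_gt_at_top[of 1]
    proof eventually_elim
      case (elim h)
      have "1 / ln h \<le> 1 / f h" using elim by (intro divide_left_mono) auto
      moreover have "0 \<le> 1 / (ln h)\<^sup>2" by simp
      ultimately show ?case by linarith
    qed
  qed blast
  obtain K' where K': "\<forall>\<^sub>F h in at_top. travel_time h \<le> h / 2 + K'"
  proof (rule eventually_le_if_DERIV_le[OF D])
    show "\<forall>\<^sub>F h in at_top. ((\<lambda>h::real. h / 2) has_real_derivative 1 / 2) (at h)"
      by (intro always_eventually allI) (auto intro!: derivative_eq_intros)
    show "\<forall>\<^sub>F h in at_top. 1 / f h \<le> 1 / 2"
      using f_far_bounds by eventually_elim (intro divide_left_mono, auto)
  qed blast
  have "\<forall>\<^sub>F h in at_top. K \<le> h / (2 * ln h)" "\<forall>\<^sub>F h in at_top. K' \<le> h / 2"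
    by real_asymp+
  with K K' show ?thesis
    by eventually_elim (simp add: field_simps)
qed

lemma travel_time_top: "filterlim travel_time at_top at_top"
proof (rule filterlim_at_top_mono)
  show "filterlim (\<lambda>h::real. h / (2 * ln h)) at_top at_top" by real_asymp
qed (use travel_time_bounds in \<open>auto elim: eventually_mono\<close>)

definition H :: "real \<Rightarrow> real" where
  "H = inv_into {0..} travel_time"

lemma travel_time_DERIV_all:
  "\<forall>h>0. (travel_time has_real_derivative 1 / f h) (at h)" "\<forall>h>0. 0 < 1 / f h"
  using DERIV_travel_time f_pos by simp_all

lemmas H_inverse = increasing_inverse[OF travel_time_cont travel_time_0
    travel_time_DERIV_all travel_time_top, folded H_def]

lemma H_0: "H 0 = 0" and H_pos: "0 < y \<Longrightarrow> 0 < H y"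
  and H_cont: "continuous_on {0..} H"
  and H_right: "filterlim H (at_right 0) (at_right 0)" and H_top: "filterlim H at_top at_top"
  and time_H: "0 \<le> y \<Longrightarrow> travel_time (H y) = y" and H_time: "0 \<le> h \<Longrightarrow> H (travel_time h) = h"
  using H_inverse by auto

lemma DERIV_H: "0 < y \<Longrightarrow> (H has_real_derivative f (H y)) (at y)"
  using H_inverse(6)[of y] by simp

lemma inv_H: "0 \<le> h \<Longrightarrow> inv_into {0..} H h = travel_time h"
proof (rule inv_into_f_eq)
  show "inj_on H {0..}" using time_H by (intro inj_on_inverseI[of _ travel_time]) auto
  show "travel_time h \<in> {0..}" if "0 \<le> h"
    using H_inverse(5)[of h] travel_time_0 that by (cases "h = 0") (auto simp: less_imp_le)
qed (rule H_time)

lemma DERIV_f_H: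
  assumes "0 < y" shows "((\<lambda>y. f (H y)) has_real_derivative V (H y) + deriv P (H y)) (at y)"
  using DERIV_chain2[OF DERIV_f[OF H_pos[OF assms]] DERIV_H[OF assms]] f_pos[OF H_pos[OF assms]] by simp

lemma DERIV_V_H:
  assumes "0 < y" shows "((\<lambda>y. V (H y)) has_real_derivative - U / (H y)\<^sup>2) (at y)"
  using DERIV_chain2[OF DERIV_V[OF H_pos[OF assms]] DERIV_H[OF assms]] f_pos[OF H_pos[OF assms]] by simp

lemma deriv_H: "0 < y \<Longrightarrow> deriv H y = f (H y)"
  by (rule DERIV_imp_deriv[OF DERIV_H])

lemma DERIV_deriv_H:
  assumes "0 < y" shows "(deriv H has_real_derivative V (H y) + deriv P (H y)) (at y)"
  by (rule has_field_derivative_transform_within_open[OF DERIV_f_H[OF assms], of "{0<..}"])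
     (use assms deriv_H in auto)

lemma deriv2_H: "0 < y \<Longrightarrow> deriv (deriv H) y = V (H y) + deriv P (H y)"
  by (rule DERIV_imp_deriv[OF DERIV_deriv_H])

lemma DERIV_deriv2_H:
  assumes "0 < y"
  shows "(deriv (deriv H) has_real_derivative - U / (H y)\<^sup>2 + deriv (deriv P) (H y) * f (H y)) (at y)"
proof (rule has_field_derivative_transform_within_open[of _ _ _ "{0<..}"])
  show "((\<lambda>y. V (H y) + deriv P (H y)) has_real_derivative - U / (H y)\<^sup>2 + deriv (deriv P) (H y) * f (H y)) (at y)"
    by (intro DERIV_add DERIV_V_H DERIV_chain2[OF DERIV_P' DERIV_H] H_pos assms)
qed (use assms deriv2_H in auto)

lemma H_C3: "C_diff_on 3 H {0<..}"
  unfolding C_diff_on_def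
proof (intro conjI allI impI ballI)
  fix j y assume j: "j < (3::nat)" and y: "y \<in> {0::real<..}"
  consider "j = 0" | "j = 1" | "j = 2" using j by linarith
  then show "(deriv ^^ j) H field_differentiable at y"
    by cases (use y DERIV_H[of y] DERIV_deriv_H[of y] DERIV_deriv2_H[of y] in
      \<open>auto simp: field_differentiable_def numeral_2_eq_2\<close>)
next
  have P'': "continuous_on {0<..} (deriv (deriv P))"
    using P_C2 by (simp add: C_diff_on_def numeral_2_eq_2)
  have f: "continuous_on {0<..} f"
    by (intro continuous_at_imp_continuous_on ballI DERIV_isCont[OF DERIV_f]) auto
  have H: "continuous_on {0<..} H" by (rule continuous_on_subset[OF H_cont]) auto
  have "continuous_on {0<..} (\<lambda>y. - U / (H y)\<^sup>2 + deriv (deriv P) (H y) * f (H y))"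
    by (intro continuous_intros H continuous_on_compose2[OF P'' H] continuous_on_compose2[OF f H])
       (use H_pos in force)+
  then show "continuous_on {0<..} ((deriv ^^ 3) H)"
    by (rule continuous_on_eq) (use DERIV_imp_deriv[OF DERIV_deriv2_H] in \<open>simp add: numeral_3_eq_3\<close>)
qed

text \<open>The growth law is known in terms of ln \<open>H(y)\<close>; the bounds on the travel time show that its quotient with ln \<open>y\<close>
  tends to \<open>1\<close>.\<close>

lemma H_far: "((\<lambda>y. deriv H y ^ 3 / ln y) \<longlongrightarrow> 3 * U) at_top"
proof -
  have "((\<lambda>h. ln (travel_time h) / ln h) \<longlongrightarrow> 1) at_top"
  proof (rule tendsto_sandwich[OF _ _ _ tendsto_const])
    show "((\<lambda>h::real. ln (h / (2 * ln h)) / ln h) \<longlongrightarrow> 1) at_top" by real_asymp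
    have "\<forall>\<^sub>F h::real in at_top. 0 < h / (2 * ln h)" by real_asymp
    with travel_time_bounds eventually_gt_at_top[of 1]
    have *: "\<forall>\<^sub>F h in at_top. ln (h / (2 * ln h)) / ln h \<le> ln (travel_time h) / ln h \<and>
        ln (travel_time h) / ln h \<le> 1"
    proof eventually_elim
      case (elim h)
      then have le: "ln (h / (2 * ln h)) \<le> ln (travel_time h)" "ln (travel_time h) \<le> ln h"
        by (subst ln_le_cancel_iff; linarith)+
      have "ln (h / (2 * ln h)) / ln h \<le> ln (travel_time h) / ln h"
        "ln (travel_time h) / ln h \<le> ln h / ln h"
        by (rule divide_right_mono, rule le, use elim in simp)+
      moreover have "ln h / ln h = 1" using elim by simp
      ultimately show ?case by (metis conjI)
    qed
    show "\<forall>\<^sub>F h in at_top. ln (h / (2 * ln h)) / ln h \<le> ln (travel_time h) / ln h"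
      "\<forall>\<^sub>F h in at_top. ln (travel_time h) / ln h \<le> 1"
      using * by (auto elim: eventually_mono)
  qed
  then have "((\<lambda>y. ln (travel_time (H y)) / ln (H y)) \<longlongrightarrow> 1) at_top"
    by (rule filterlim_compose[OF _ H_top])
  moreover have "((\<lambda>y. f (H y) ^ 3 / ln (H y)) \<longlongrightarrow> 3 * U) at_top"
    by (rule filterlim_compose[OF f_cube_over_ln H_top])
  ultimately have lim: "((\<lambda>y. (f (H y) ^ 3 / ln (H y)) / (ln (travel_time (H y)) / ln (H y))) \<longlongrightarrow> 3 * U / 1) at_top"
    by (intro tendsto_divide) auto
  have "\<forall>\<^sub>F y in at_top. 1 < H y" using H_top by (simp add: filterlim_at_top_dense)
  then have "\<forall>\<^sub>F y in at_top. (f (H y) ^ 3 / ln (H y)) / (ln (travel_time (H y)) / ln (H y)) = deriv H y ^ 3 / ln y"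
    using eventually_gt_at_top[of 0] by eventually_elim (simp add: deriv_H time_H)
  from Lim_transform_eventually[OF lim this] show ?thesis by simp
qed

lemma H_solution: "is_solution U \<Theta> P H"
  unfolding is_solution_def
proof (intro conjI allI impI H_C3 H_cont H_0 H_far)
  show "0 < H y" if "0 < y" for y by (rule H_pos[OF that])
  fix y :: real assume y: "0 < y"
  have "((\<lambda>t. deriv (deriv H) t - deriv P (H t)) has_real_derivative - U / (H y)\<^sup>2) (at y)"
    by (rule has_field_derivative_transform_within_open[OF DERIV_V_H[OF y], of "{0<..}"])
       (use y deriv2_H in auto)
  then show "(H y)\<^sup>2 * deriv (\<lambda>t. deriv (deriv H) t - deriv P (H t)) y = - U"
    using DERIV_imp_deriv H_pos[OF y] by fastforce
next
  show "((\<lambda>y. (deriv H y)\<^sup>2 / 2 - P (H y)) \<longlongrightarrow> \<Theta>) (at_right 0)"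
  proof (rule Lim_transform_eventually[OF filterlim_compose[OF E_right H_right]])
    show "\<forall>\<^sub>F y in at_right 0. E (H y) = (deriv H y)\<^sup>2 / 2 - P (H y)"
      using eventually_at_right_less[of 0] by eventually_elim (simp add: deriv_H f_sq H_pos add_divide_distrib)
  qed
qed

text \<open>The power \<open>(m + 1)/2\<close> of \<open>H\<close> has the derivative \<open>(m + 1)/2\<close> times \<open>f(H)\<close> divided by \<open>H\<close> to the power \<open>(1 - m)/2\<close>,
  which tends to \<open>\<beta> = (m + 1)/2 sqrt(2 A / (m - 1))\<close>. Therefore this power of \<open>H\<close> is asymptotic to \<open>\<beta> y\<close>, and
  \<open>\<alpha>\<close> is \<open>\<beta>\<close> to the power \<open>2/(m + 1)\<close>.\<close>

lemma H_near_0: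
  defines "\<alpha> \<equiv> (A * (m + 1)\<^sup>2 / (2 * (m - 1))) powr (1 / (m + 1))"
  shows "H \<sim>[at_right 0] (\<lambda>y. \<alpha> * y powr (2 / (m + 1)))"
    and "deriv H \<sim>[at_right 0] (\<lambda>y. 2 * \<alpha> / (m + 1) * y powr ((1 - m) / (m + 1)))"
proof -
  define a where "a = sqrt (2 * A / (m - 1))"
  define \<beta> where "\<beta> = (m + 1) / 2 * a"
  have a: "0 < a" and \<beta>: "0 < \<beta>" using A m by (auto simp: a_def \<beta>_def)
  have speed: "((\<lambda>y. f (H y) / H y powr ((1 - m) / 2)) \<longlongrightarrow> a) (at_right 0)"
    unfolding a_def by (rule filterlim_compose[OF f_near_0 H_right])
  have "a\<^sup>2 = 2 * A / (m - 1)" using A m by (simp add: a_def)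
  then have \<beta>2: "\<beta>\<^sup>2 = A * (m + 1)\<^sup>2 / (2 * (m - 1))"
    unfolding \<beta>_def power_mult_distrib by (simp add: power_divide)
  have \<alpha>: "\<alpha> = \<beta> powr (2 / (m + 1))"
    unfolding \<alpha>_def \<beta>2[symmetric] using \<beta> by (simp add: powr_powr flip: powr_numeral)
  have \<alpha>_pos: "0 < \<alpha>" using \<beta> by (simp add: \<alpha>)
  have \<alpha>_root: "\<alpha> powr ((m + 1) / 2) = \<beta>"
  proof -
    have "2 / (m + 1) * ((m + 1) / 2) = 1" using m by simp
    then show ?thesis using \<beta> by (simp only: \<alpha> powr_powr powr_one)
  qed
  have power: "((\<lambda>y. H y powr ((m + 1) / 2) / y) \<longlongrightarrow> \<beta>) (at_right 0)"
  proof (rule lhopital_right_0)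
    have "((\<lambda>h. h powr ((m + 1) / 2)) \<longlongrightarrow> 0) (at_right 0)" using m by real_asymp
    then show "((\<lambda>y. H y powr ((m + 1) / 2)) \<longlongrightarrow> 0) (at_right 0)"
      by (rule filterlim_compose[OF _ H_right])
    show "\<forall>\<^sub>F y in at_right 0. ((\<lambda>y. H y powr ((m + 1) / 2)) has_real_derivative
        (m + 1) / 2 * (f (H y) / H y powr ((1 - m) / 2))) (at y)"
      using eventually_at_right_less[of 0]
    proof eventually_elim
      case (elim y)
      have "((\<lambda>y. H y powr ((m + 1) / 2)) has_real_derivative
          ((m + 1) / 2 * H y powr ((m + 1) / 2 - 1)) * f (H y)) (at y)"
        by (rule DERIV_chain2[OF has_real_derivative_powr[OF H_pos[OF elim]] DERIV_H[OF elim]])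
      moreover have "H y powr ((m + 1) / 2 - 1) = 1 / H y powr ((1 - m) / 2)"
      proof -
        have "(m + 1) / 2 - 1 = - ((1 - m) / 2)" by (simp add: field_simps)
        then show ?thesis by (simp only: powr_minus_divide)
      qed
      ultimately show ?case by (simp add: mult.commute)
    qed
    show "((\<lambda>y. (m + 1) / 2 * (f (H y) / H y powr ((1 - m) / 2)) / 1) \<longlongrightarrow> \<beta>) (at_right 0)"
      unfolding \<beta>_def div_by_1 by (intro tendsto_mult tendsto_const speed)
  qed (use eventually_at_right_less[of 0] in \<open>auto elim: eventually_mono\<close>)
  have height: "((\<lambda>y. H y / y powr (2 / (m + 1))) \<longlongrightarrow> \<alpha>) (at_right 0)"
  proof (rule Lim_transform_eventually)
    show "((\<lambda>y. (H y powr ((m + 1) / 2) / y) powr (2 / (m + 1))) \<longlongrightarrow> \<alpha>) (at_right 0)"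
      unfolding \<alpha> by (intro tendsto_powr power tendsto_const) (use \<beta> in auto)
    show "\<forall>\<^sub>F y in at_right 0. (H y powr ((m + 1) / 2) / y) powr (2 / (m + 1)) = H y / y powr (2 / (m + 1))"
      using eventually_at_right_less[of 0]
    proof eventually_elim
      case (elim y)
      have "(m + 1) / 2 * (2 / (m + 1)) = 1" using m by simp
      then have "(H y powr ((m + 1) / 2)) powr (2 / (m + 1)) = H y"
        using H_pos[OF elim] by (simp only: powr_powr powr_one)
      then show ?case using elim by (simp add: powr_divide)
    qed
  qed
  show "H \<sim>[at_right 0] (\<lambda>y. \<alpha> * y powr (2 / (m + 1)))"
  proof (rule asymp_equivI')
    have "((\<lambda>y. (H y / y powr (2 / (m + 1))) / \<alpha>) \<longlongrightarrow> \<alpha> / \<alpha>) (at_right 0)"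
      by (intro tendsto_divide height tendsto_const) (use \<alpha>_pos in simp)
    then show "((\<lambda>y. H y / (\<alpha> * y powr (2 / (m + 1)))) \<longlongrightarrow> 1) (at_right 0)"
      using \<alpha>_pos by (simp add: field_simps)
  qed
  show "deriv H \<sim>[at_right 0] (\<lambda>y. 2 * \<alpha> / (m + 1) * y powr ((1 - m) / (m + 1)))"
  proof (rule asymp_equivI')
    have val: "a * \<alpha> powr ((1 - m) / 2) = 2 * \<alpha> / (m + 1)"
    proof -
      have "\<alpha> powr ((1 - m) / 2) * \<alpha> powr ((m + 1) / 2) = \<alpha>"
        using \<alpha>_pos by (simp add: field_simps flip: powr_add)
      then have "\<alpha> powr ((1 - m) / 2) * ((m + 1) / 2 * a) = \<alpha>" unfolding \<alpha>_root \<beta>_def .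
      then show ?thesis using m by (simp add: field_simps)
    qed
    have lim: "((\<lambda>y. (f (H y) / H y powr ((1 - m) / 2)) * (H y / y powr (2 / (m + 1))) powr ((1 - m) / 2)
        / (2 * \<alpha> / (m + 1))) \<longlongrightarrow> (2 * \<alpha> / (m + 1)) / (2 * \<alpha> / (m + 1))) (at_right 0)"
      unfolding val[symmetric]
      by (intro tendsto_divide tendsto_mult tendsto_powr speed height tendsto_const)
         (use \<alpha>_pos a in auto)
    have ev: "\<forall>\<^sub>F y in at_right 0. (f (H y) / H y powr ((1 - m) / 2)) * (H y / y powr (2 / (m + 1))) powr ((1 - m) / 2)
        / (2 * \<alpha> / (m + 1)) = deriv H y / (2 * \<alpha> / (m + 1) * y powr ((1 - m) / (m + 1)))"
      using eventually_at_right_less[of 0]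
    proof eventually_elim
      case (elim y)
      have "(H y / y powr (2 / (m + 1))) powr ((1 - m) / 2) = H y powr ((1 - m) / 2) / y powr ((1 - m) / (m + 1))"
      proof -
        have "2 / (m + 1) * ((1 - m) / 2) = (1 - m) / (m + 1)"
          using m by (subst times_divide_times_eq, subst frac_eq_eq) (auto simp: algebra_simps)
        then show ?thesis by (simp only: powr_divide powr_powr)
      qed
      then show ?case using H_pos[OF elim] by (simp add: deriv_H[OF elim])
    qed
    show "((\<lambda>y. deriv H y / (2 * \<alpha> / (m + 1) * y powr ((1 - m) / (m + 1)))) \<longlongrightarrow> 1) (at_right 0)"
      using Lim_transform_eventually[OF lim ev] \<alpha>_pos m by simp
  qed
qed

lemma H_speed_at_height:
  "(\<lambda>h. (deriv H (inv_into {0..} H h)) ^ 3 / (3 * U) - (ln h - ln (ln h) / 3 + ln (exp c)))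
     \<in> O[at_top](\<lambda>h. ln (ln h) / ln h)"
proof (rule landau_o.big.in_cong[THEN iffD1, OF _ f_far])
  show "\<forall>\<^sub>F h in at_top. f h ^ 3 / (3 * U) - (ln h - ln (ln h) / 3 + c) =
      (deriv H (inv_into {0..} H h)) ^ 3 / (3 * U) - (ln h - ln (ln h) / 3 + ln (exp c))"
    using eventually_gt_at_top[of 0]
  proof eventually_elim
    case (elim h)
    have "0 < travel_time h" using H_inverse(5)[OF elim] .
    then show ?case using elim by (simp add: inv_H deriv_H H_time)
  qed
qed

end

section \<open>The film problem\<close>

theorem theorem1p1:
  fixes U \<Theta>\<^sub>0 m A \<alpha> :: real and P :: "real \<Rightarrow> real"
  assumes "U > 0" and "\<Theta>\<^sub>0 > 0"
    and "C_diff_on 2 P {0<..}"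
    and "m > 1" and "A > 0"
    and "P \<sim>[at_right 0] (\<lambda>h. A / (m - 1) * h powr (1 - m))"
    and "(P \<longlongrightarrow> 0) at_top" and "(deriv P \<longlongrightarrow> 0) at_top"
    and "\<exists>p>1. (\<lambda>h. h powr (p + 1) * deriv (deriv P) h) \<in> O[at_top](\<lambda>_. 1)"
    and "(INF h\<in>{0<..}. P h) + \<Theta>\<^sub>0 > 0"
  defines "\<alpha> \<equiv> (A * (m + 1)\<^sup>2 / (2 * (m - 1))) powr (1 / (m + 1))"
  shows "\<exists>H. is_solution U \<Theta>\<^sub>0 P H \<and> (\<forall>y>0. deriv H y > 0) \<and>
           (\<forall>G. is_solution U \<Theta>\<^sub>0 P G \<and> (\<forall>y>0. deriv G y > 0) \<longrightarrow> (\<forall>y\<ge>0. G y = H y)) \<and>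
           H \<sim>[at_right 0] (\<lambda>y. \<alpha> * y powr (2 / (m + 1))) \<and>
           deriv H \<sim>[at_right 0] (\<lambda>y. 2 * \<alpha> / (m + 1) * y powr ((1 - m) / (m + 1))) \<and>
           (\<exists>B>0. (\<lambda>h. (deriv H (inv_into {0..} H h)) ^ 3 / (3 * U)
                        - (ln h - ln (ln h) / 3 + ln B)) \<in> O[at_top](\<lambda>h. ln (ln h) / ln h))"
proof -
  interpret film_potential U \<Theta>\<^sub>0 m A P
    by unfold_locales (fact assms)+
  obtain E V f c where
    "\<And>h. 0 < h \<Longrightarrow> (E has_real_derivative V h) (at h)"
    "\<And>h. 0 < h \<Longrightarrow> (V has_real_derivative - U / (h\<^sup>2 * f h)) (at h)"
    "\<And>h. 0 < h \<Longrightarrow> 0 < f h" "\<And>h. 0 < h \<Longrightarrow> (f h)\<^sup>2 = 2 * (E h + P h)"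
    "(E \<longlongrightarrow> \<Theta>\<^sub>0) (at_right 0)"
    "(\<lambda>h. f h ^ 3 / (3 * U) - (ln h - ln (ln h) / 3 + c)) \<in> O[at_top](\<lambda>h. ln (ln h) / ln h)"
    using speed by blast
  then have "film_speed U \<Theta>\<^sub>0 m A P E V f c" by unfold_locales
  then interpret film_speed U \<Theta>\<^sub>0 m A P E V f c .
  have deriv_pos: "0 < deriv H y" if "0 < y" for y
    using deriv_H[OF that] f_pos[OF H_pos[OF that]] by simp
  have "\<forall>G. is_solution U \<Theta>\<^sub>0 P G \<and> (\<forall>y>0. deriv G y > 0) \<longrightarrow> (\<forall>y\<ge>0. G y = H y)"
    using solution_unique[OF U P_C2 P_top _ _ H_solution deriv_pos] by blast
  moreover have "\<exists>B>0. (\<lambda>h. (deriv H (inv_into {0..} H h)) ^ 3 / (3 * U)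
      - (ln h - ln (ln h) / 3 + ln B)) \<in> O[at_top](\<lambda>h. ln (ln h) / ln h)"
    using H_speed_at_height exp_gt_zero by blast
  ultimately show ?thesis
    unfolding \<alpha>_def using H_solution deriv_pos H_near_0 by blast
qed

end
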